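(* For $k \ge 2$, the function $F_k(x,y)$ is expressed as $F_k = f_k(Z,W)$ with \[ f_k(z,w) = \frac{w^2}{(1-w)^{3(k-1)}} \sum_{j=0}^{k-1} q_{k,j}(w)z^j, \] where each $q_{k,j}(w)$ is a polynomial in $w$.
   Context: For integers $r,s\ge 0$ and $k$, $N_{\rm bi}(r,s,k)$ is the number of connected bipartite simple graphs with labeled bipartition $V_1\sqcup V_2$, $|V_1|=r$, $|V_2|=s$, having exactly $r+s+k-1$ edges; equivalently, the number of connected spanning subgraphs of the complete bipartite graph $K_{r,s}$ with $r+s+k-1$ edges (so the Betti number is $k$). Conventions: if $rs=0$, then $N_{\rm bi}(r,s,k)=1$ if $k=0$ and $(r,s)\in\{(1,0),(0,1)\}$, and $0$ otherwise. It is known that $N_{\rm bi}(r,s,0)=r^{s-1}s^{r-1}$ for $r,s\ge1$. For $k\ge 0$ let $F_k(x,y) = \sum_{r,s=0}^{\infty} \frac{N_{\rm bi}(r,s,k)}{r!s!}x^r y^s$ (formal power series), and put $T:=F_0$. With the Euler operators $D_x=x\partial_x$, $D_y=y\partial_y$, put $T_x = D_xT$, $T_y=D_yT$, $Z=T_x+T_y$, $W=T_xT_y$. *)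

theory Defs
  imports "HOL-Computational_Algebra.Computational_Algebra"
begin

text \<open>Vertices are \<open>Inl i\<close> (\<open>i < r\<close>, the part \<open>V\<^sub>1\<close>) and \<open>Inr j\<close> (\<open>j < s\<close>, the part \<open>V\<^sub>2\<close>);
  edges are two-element sets of vertices.\<close>

type_synonym vertex = "nat + nat"

definition bip_verts :: "nat \<Rightarrow> nat \<Rightarrow> vertex set" where
  "bip_verts r s = Inl ` {..<r} \<union> Inr ` {..<s}"

definition complete_bip_edges :: "nat \<Rightarrow> nat \<Rightarrow> vertex set set" where
  "complete_bip_edges r s = {{Inl i, Inr j} | i j. i < r \<and> j < s}"

definition connected_graph :: "'v set \<Rightarrow> 'v set set \<Rightarrow> bool" where
  "connected_graph V E \<longleftrightarrow> V \<noteq> {} \<and> (\<forall>u\<in>V. \<forall>v\<in>V. (u, v) \<in> {(a, b). {a, b} \<in> E}\<^sup>*)"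

text \<open>The edge count is \<open>r + s + k - 1\<close>, written without truncated subtraction.\<close>

definition N_bi :: "nat \<Rightarrow> nat \<Rightarrow> nat \<Rightarrow> nat" where
  "N_bi r s k =
    (if r * s = 0 then (if k = 0 \<and> (r, s) \<in> {(1, 0), (0, 1)} then 1 else 0)
     else card {E. E \<subseteq> complete_bip_edges r s \<and>
                   connected_graph (bip_verts r s) E \<and> card E + 1 = r + s + k})"

text \<open>The ring of formal power series in \<open>x, y\<close> over the rationals is modelled as the iterated
  ring \<open>\<rat>[[y]][[x]]\<close>: the coefficient of \<open>x^r y^s\<close> in \<open>A\<close> is \<open>fps_nth (fps_nth A r) s\<close>.\<close>

type_synonym fps2 = "rat fps fps"

definition F :: "nat \<Rightarrow> fps2" where
  "F k = Abs_fps (\<lambda>r. Abs_fps (\<lambda>s. of_nat (N_bi r s k) / (fact r * fact s)))"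

definition D_x :: "fps2 \<Rightarrow> fps2" where
  "D_x A = fps_XD A"

definition D_y :: "fps2 \<Rightarrow> fps2" where
  "D_y A = Abs_fps (\<lambda>r. fps_XD (fps_nth A r))"

definition T :: fps2 where "T = F 0"

definition T_x :: fps2 where "T_x = D_x T"

definition T_y :: fps2 where "T_y = D_y T"

definition Z :: fps2 where "Z = T_x + T_y"

definition W :: fps2 where "W = T_x * T_y"

text \<open>Evaluation of a one-variable rational polynomial at a power series in \<open>x, y\<close>.\<close>

definition eval_poly :: "rat poly \<Rightarrow> fps2 \<Rightarrow> fps2" where
  "eval_poly p A = poly (map_poly (\<lambda>c. fps_const (fps_const c)) p) A"

text \<open>Division in the library is total on \<open>fps2\<close>, although the coefficient ring \<open>\<rat>[[y]]\<close> is
  not a field; for denominators that are powers of \<open>1 - W\<close> it is genuine division.\<close>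

lemma divide_one_minus_W_power: "A / (1 - W) ^ n * (1 - W) ^ n = A"
proof -
  define B where "B = (1 - W) ^ n"
  have B0: "fps_nth B 0 = 1"
    by (simp add: B_def W_def T_x_def D_x_def fps_power_zeroth)
  have "inverse (1 :: rat fps) = 1"
    by simp
  then have inv: "B * inverse B = 1"
    unfolding fps_inverse_def[of B] using B0
    by (metis fps_right_inverse mult_1)
  have "subdegree B = 0"
    using B0 by (intro subdegree_eq_0) simp
  then have "A / B = A * inverse B"
    by (simp only: fps_divide_def fps_shift_0 fps_unit_factor_def)
  with inv have "A / B * B = A"
    by (simp only: mult.assoc mult.commute[of "inverse B"] mult_1_right)
  then show ?thesis
    by (simp only: B_def)
qed

end

theory Submission
  imports Defs
begin

text \<open>Deleting the component of a root shows that the exponential generating function \<open>G\<close> of connected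
  bipartite graphs, edges marked by \<open>t\<close>, is the logarithm of \<open>P = \<Sum> (1 + t)^(r s) x^r y^s / (r! s!)\<close>.
  Two identities for \<open>P\<close> carry over to \<open>G\<close>. From \<open>(1 + t) \<partial>\<^sub>t P = D_x D_y P\<close> one gets, in the
  coordinates \<open>X = T_x\<close>, \<open>Y = T_y\<close>, a recursion \<open>(k + E) F\<^sub>k\<^sub>+\<^sub>1 = H\<^sub>k\<close> in which \<open>E = X \<partial>\<^sub>X + Y \<partial>\<^sub>Y\<close>;
  it controls pole orders and monomial supports, but solving it could create logarithms. From
  \<open>D_x P(x, y) = x P(x, (1 + t) y)\<close> one gets a second recursion, without integration, which shows that
  the derivatives of all \<open>F\<^sub>k\<close> are polynomials in \<open>X\<close>, \<open>Y\<close> and \<open>1 / (1 - X Y)\<close>. Together they give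
  \<open>F\<^sub>k = A / (1 - W)^(3 (k - 1))\<close> where \<open>A\<close> involves only monomials \<open>X\<^sup>a Y\<^sup>b\<close> with \<open>a, b \<ge> 2\<close> and
  \<open>\<bar>a - b\<bar> \<le> k - 1\<close>, and symmetry in \<open>x, y\<close> turns \<open>A\<close> into a polynomial in \<open>Z\<close> and \<open>W\<close>.\<close>


subsection \<open>Coefficientwise operators on \<open>fps fps\<close>\<close>

unbundle fps_syntax

text \<open>The logarithm does occur: \<open>F 1\<close> equals
  \<open>-(W + log (1 - W)) / 2\<close> and lies outside the algebra. It stays harmless because the
  recursion for the derivatives meets \<open>F 1\<close> only under \<open>D_x\<close> or
  \<open>D_y\<close>, and because in the recursion with \<open>E\<close> the series
  \<open>F k\<close> itself carries the factor \<open>k - 1\<close>. Hence the inductions carry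
  derivatives for every k, but \<open>F k\<close> itself only for k \<ge> 2.

  The operator \<open>E\<close> comes from the two extreme terms of the convolution, which contain
  \<open>F (k + 1)\<close> next to \<open>T_x\<close> or \<open>T_y\<close>. Together with the
  linear terms they form \<open>(1 - T_y) D_x + (1 - T_x) D_y\<close>, and this operator fixes
  \<open>T_x\<close> and \<open>T_y\<close>.

  The exponent 3 (k - 1): each of \<open>D_x\<close>, \<open>D_y\<close> raises the order of the
  pole along W = 1 by at most two, so \<open>D_x D_y F_k\<close> has order at most 3 (k - 1) + 4 = 3
  k + 1, and so have the products \<open>D_x F_i * D_y F_(k+1-i)\<close>. As \<open>E\<close> raises
  a pole order by one, \<open>F (k + 1)\<close> is left with 3 k. A mixed second derivative widens
  the support by one only, because \<open>T_x * T_y = W\<close> lies on the diagonal.\<close>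

definition coeffwise :: "(nat \<Rightarrow> nat \<Rightarrow> 'a \<Rightarrow> 'b) \<Rightarrow> 'a fps fps \<Rightarrow> 'b fps fps" where
  "coeffwise f A = Abs_fps (\<lambda>r. Abs_fps (\<lambda>s. f r s (A $ r $ s)))"

lemma coeffwise_nth [simp]: "coeffwise f A $ r $ s = f r s (A $ r $ s)"
  by (simp add: coeffwise_def)

lemma fps2_eqI: "(\<And>r s. A $ r $ s = B $ r $ s) \<Longrightarrow> A = B"
  by (simp add: fps_eq_iff)

lemma fps2_mult_nth:
  "(A * B) $ r $ s = (\<Sum>i=0..r. \<Sum>j=0..s. A $ i $ j * B $ (r - i) $ (s - j))"
  for A B :: "'a :: semiring_0 fps fps"
  by (simp add: fps_mult_nth fps_sum_nth)

text \<open>The Cauchy product pairs coefficients whose indices add up, so multiplicativity along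
  the bigrading suffices. The substitutions \<open>y -> (1 + t) y\<close> and
  \<open>(x, y) -> (t x, t y)\<close> are of this kind.\<close>

lemma coeffwise_mult_hom:
  fixes f :: "nat \<Rightarrow> nat \<Rightarrow> 'a :: semiring_0 \<Rightarrow> 'b :: semiring_0"
  assumes zero: "\<And>r s. f r s 0 = 0"
    and add: "\<And>r s a b. f r s (a + b) = f r s a + f r s b"
    and mult: "\<And>i j k l a b. f (i + k) (j + l) (a * b) = f i j a * f k l b"
  shows "coeffwise f (A * B) = coeffwise f A * coeffwise f B"
proof (rule fps2_eqI)
  fix r s
  have f_sum: "f r s (sum g K) = (\<Sum>x\<in>K. f r s (g x))" for g :: "nat \<Rightarrow> 'a" and K
    by (induction K rule: infinite_finite_induct) (simp_all add: zero add)
  have "f r s (A $ i $ j * B $ (r - i) $ (s - j)) = f i j (A $ i $ j) * f (r - i) (s - j) (B $ (r - i) $ (s - j))"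
    if "i \<le> r" "j \<le> s" for i j
    using mult[of i "r - i" j "s - j"] that by simp
  then show "coeffwise f (A * B) $ r $ s = (coeffwise f A * coeffwise f B) $ r $ s"
    by (simp add: fps2_mult_nth f_sum)
qed

lemma coeffwise_mult_derivation:
  fixes f :: "nat \<Rightarrow> nat \<Rightarrow> 'a :: semiring_0 \<Rightarrow> 'a"
  assumes zero: "\<And>r s. f r s 0 = 0"
    and add: "\<And>r s a b. f r s (a + b) = f r s a + f r s b"
    and mult: "\<And>i j k l a b. f (i + k) (j + l) (a * b) = f i j a * b + a * f k l b"
  shows "coeffwise f (A * B) = coeffwise f A * B + A * coeffwise f B"
proof (rule fps2_eqI)
  fix r s
  have f_sum: "f r s (sum g K) = (\<Sum>x\<in>K. f r s (g x))" for g :: "nat \<Rightarrow> 'a" and K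
    by (induction K rule: infinite_finite_induct) (simp_all add: zero add)
  have "f r s (A $ i $ j * B $ (r - i) $ (s - j))
      = f i j (A $ i $ j) * B $ (r - i) $ (s - j) + A $ i $ j * f (r - i) (s - j) (B $ (r - i) $ (s - j))"
    if "i \<le> r" "j \<le> s" for i j
    using mult[of i "r - i" j "s - j"] that by simp
  then show "coeffwise f (A * B) $ r $ s = (coeffwise f A * B + A * coeffwise f B) $ r $ s"
    by (simp add: fps2_mult_nth f_sum sum.distrib)
qed

lemma coeffwise_add:
  assumes "\<And>r s a b. f r s (a + b) = f r s a + f r s b"
  shows "coeffwise f (A + B) = coeffwise f A + coeffwise f B"
  by (rule fps2_eqI) (simp add: assms)

lemma coeffwise_diff:
  assumes "\<And>r s a b. f r s (a - b) = f r s a - f r s b"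
  shows "coeffwise f (A - B) = coeffwise f A - coeffwise f B"
  by (rule fps2_eqI) (simp add: assms)

definition fps2_swap :: "'a fps fps \<Rightarrow> 'a fps fps" where
  "fps2_swap A = Abs_fps (\<lambda>r. Abs_fps (\<lambda>s. A $ s $ r))"

lemma fps2_swap_nth [simp]: "fps2_swap A $ r $ s = A $ s $ r"
  by (simp add: fps2_swap_def)

lemma fps2_swap_swap [simp]: "fps2_swap (fps2_swap A) = A"
  by (rule fps2_eqI) simp

lemma fps2_swap_mult: "fps2_swap (A * B) = fps2_swap A * fps2_swap B"
  for A B :: "'a :: semiring_0 fps fps"
proof (rule fps2_eqI)
  fix r s
  show "fps2_swap (A * B) $ r $ s = (fps2_swap A * fps2_swap B) $ r $ s"
    unfolding fps2_swap_nth fps2_mult_nth by (rule sum.swap)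
qed

lemma fps2_swap_add: "fps2_swap (A + B) = fps2_swap A + fps2_swap B"
  by (rule fps2_eqI) simp

lemma fps2_swap_diff: "fps2_swap (A - B) = fps2_swap A - fps2_swap B"
  by (rule fps2_eqI) simp

lemma fps2_swap_one: "fps2_swap 1 = (1 :: 'a :: semiring_1 fps fps)"
  by (rule fps2_eqI) auto

lemma fps2_swap_zero [simp]: "fps2_swap 0 = (0 :: 'a :: zero fps fps)"
  by (rule fps2_eqI) simp

lemma fps2_swap_power: "fps2_swap (A ^ n) = fps2_swap A ^ n" for A :: "'a :: comm_semiring_1 fps fps"
  by (induction n) (simp_all add: fps2_swap_one fps2_swap_mult)

text \<open>Polymorphic in the coefficient ring: it acts over the rationals on the
  \<open>F k\<close> and over power series in \<open>t\<close> on the series with marked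
  edges.\<close>

definition Dx :: "'a :: comm_ring_1 fps fps \<Rightarrow> 'a fps fps" where
  "Dx = coeffwise (\<lambda>r s a. of_nat r * a)"

definition Dy :: "'a :: comm_ring_1 fps fps \<Rightarrow> 'a fps fps" where
  "Dy = coeffwise (\<lambda>r s a. of_nat s * a)"

lemma Dx_nth [simp]: "Dx A $ r $ s = of_nat r * A $ r $ s"
  and Dy_nth [simp]: "Dy A $ r $ s = of_nat s * A $ r $ s"
  by (simp_all add: Dx_def Dy_def)

lemma Dx_mult: "Dx (A * B) = Dx A * B + A * Dx B"
  and Dy_mult: "Dy (A * B) = Dy A * B + A * Dy B"
  unfolding Dx_def Dy_def by (rule coeffwise_mult_derivation; simp add: algebra_simps)+

lemma Dx_add: "Dx (A + B) = Dx A + Dx B"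
  and Dy_add: "Dy (A + B) = Dy A + Dy B"
  and Dx_diff: "Dx (A - B) = Dx A - Dx B"
  and Dy_diff: "Dy (A - B) = Dy A - Dy B"
  unfolding Dx_def Dy_def by (rule coeffwise_add coeffwise_diff; simp add: algebra_simps)+

lemma Dx_Dy_commute: "Dx (Dy A) = Dy (Dx A)"
  by (rule fps2_eqI) (simp add: algebra_simps)

lemma swap_Dx: "fps2_swap (Dx A) = Dy (fps2_swap A)"
  and swap_Dy: "fps2_swap (Dy A) = Dx (fps2_swap A)"
  by (rule fps2_eqI; simp)+

text \<open>Since \<open>B\<close> has no part free of \<open>x\<close>, row \<open>r\<close> of
  \<open>B * Q\<close> involves only earlier rows of \<open>Q\<close>. These vanish by induction,
  and the factor \<open>r\<close> on the left can be cancelled.\<close>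

lemma Dx_ode_unique:
  fixes Q :: "'a :: {idom, semiring_char_0} fps fps"
  assumes ode: "Dx Q = B * Q" and B: "\<And>s. B $ 0 $ s = 0" and Q: "\<And>s. Q $ 0 $ s = 0"
  shows "Q = 0"
proof -
  have "\<forall>s. Q $ r $ s = 0" for r
  proof (induction r rule: less_induct)
    case (less r)
    show ?case
    proof (cases "r = 0")
      case True
      then show ?thesis using Q by simp
    next
      case False
      show ?thesis
      proof
        fix s
        have "of_nat r * Q $ r $ s = (B * Q) $ r $ s"
          using arg_cong[OF ode, of "\<lambda>A. A $ r $ s"] by simp
        also have "\<dots> = 0"
          unfolding fps2_mult_nth
        proof (intro sum.neutral ballI)
          fix i j assume "i \<in> {0..r}"
          then show "B $ i $ j * Q $ (r - i) $ (s - j) = 0"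
            using less.IH[of "r - i"] B[of j] False by (cases "i = 0") auto
        qed
        finally show "Q $ r $ s = 0" using False by simp
      qed
    qed
  qed
  then show ?thesis by (intro fps2_eqI) simp
qed

lemma D_x_eq_Dx: "D_x = Dx"
  by (intro ext fps2_eqI) (simp add: D_x_def fps_of_nat[symmetric])

lemma D_y_eq_Dy: "D_y = Dy"
  by (intro ext fps2_eqI) (simp add: D_y_def)

subsection \<open>Connected bipartite graphs\<close>

text \<open>Arbitrary vertex sets replace initial segments because the component of a root and its
  complement can be any subsets.\<close>

definition bedges :: "nat set \<Rightarrow> nat set \<Rightarrow> vertex set set" where
  "bedges A B = (\<lambda>(i, j). {Inl i, Inr j}) ` (A \<times> B)"

definition bverts :: "nat set \<Rightarrow> nat set \<Rightarrow> vertex set" where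
  "bverts A B = Inl ` A \<union> Inr ` B"

definition adj :: "'v set set \<Rightarrow> ('v \<times> 'v) set" where
  "adj E = {(a, b). {a, b} \<in> E}"

lemma bedges_iff: "e \<in> bedges A B \<longleftrightarrow> (\<exists>i\<in>A. \<exists>j\<in>B. e = {Inl i, Inr j})"
  by (auto simp: bedges_def)

lemma bedgesE:
  assumes "e \<in> E" "E \<subseteq> bedges A B"
  obtains i j where "i \<in> A" "j \<in> B" "e = {Inl i, Inr j}"
proof -
  have "e \<in> bedges A B" using assms by blast
  then show ?thesis using that unfolding bedges_iff by blast
qed

lemma complete_bip_edges_eq: "complete_bip_edges r s = bedges {..<r} {..<s}"
  by (auto simp: complete_bip_edges_def bedges_def)

lemma bip_verts_eq: "bip_verts r s = bverts {..<r} {..<s}"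
  by (simp add: bip_verts_def bverts_def)

lemma connected_graph_iff: "connected_graph V E \<longleftrightarrow> V \<noteq> {} \<and> (\<forall>u\<in>V. \<forall>v\<in>V. (u, v) \<in> (adj E)\<^sup>*)"
  by (simp add: connected_graph_def adj_def)

lemma adj_rtrancl_sym: "(u, v) \<in> (adj E)\<^sup>* \<Longrightarrow> (v, u) \<in> (adj E)\<^sup>*"
proof -
  have "sym (adj E)" by (auto simp: adj_def sym_def insert_commute)
  then show "(u, v) \<in> (adj E)\<^sup>* \<Longrightarrow> (v, u) \<in> (adj E)\<^sup>*"
    by (meson sym_rtrancl symD)
qed

lemma adj_rtrancl_mono: "E \<subseteq> E' \<Longrightarrow> (u, v) \<in> (adj E)\<^sup>* \<Longrightarrow> (u, v) \<in> (adj E')\<^sup>*"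
  using rtrancl_mono[of "adj E" "adj E'"] by (auto simp: adj_def)

lemma adj_rtrancl_image: "(u, v) \<in> (adj E)\<^sup>* \<Longrightarrow> (h u, h v) \<in> (adj ((`) h ` E))\<^sup>*"
proof (induction rule: rtrancl_induct)
  case (step y z)
  from step(2) have "h ` {y, z} \<in> (`) h ` E"
    unfolding adj_def by blast
  then have "(h y, h z) \<in> adj ((`) h ` E)"
    by (simp add: adj_def)
  with step(3) show ?case by simp
qed simp

lemma connected_graph_image: "connected_graph V E \<Longrightarrow> connected_graph (h ` V) ((`) h ` E)"
  by (auto simp: connected_graph_iff intro: adj_rtrancl_image)

lemma finite_bedges [simp]: "finite A \<Longrightarrow> finite B \<Longrightarrow> finite (bedges A B)"
  by (simp add: bedges_def)

lemma card_bedges: "card (bedges A B) = card A * card B"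
proof -
  have "inj_on (\<lambda>(i, j). {Inl i, Inr j}) (A \<times> B)"
    by (auto simp: inj_on_def doubleton_eq_iff)
  then show ?thesis by (simp add: bedges_def card_image card_cartesian_product)
qed

lemma connected_graph_card_le:
  assumes conn: "connected_graph V E" and fin: "finite V" "finite E" and sub: "\<Union>E \<subseteq> V"
  shows "card V \<le> card E + 1"
proof -
  have grow: "Suc m \<le> card V \<Longrightarrow> \<exists>C E'. C \<subseteq> V \<and> card C = Suc m \<and> E' \<subseteq> E \<and> card E' = m \<and> \<Union>E' \<subseteq> C" for m
  proof (induction m)
    case 0
    from conn obtain v where "v \<in> V" by (auto simp: connected_graph_iff)
    then show ?case by (intro exI[of _ "{v}"] exI[of _ "{}"]) auto
  next
    case (Suc m)
    then obtain C E' where C: "C \<subseteq> V" "card C = Suc m" and E': "E' \<subseteq> E" "card E' = m" "\<Union>E' \<subseteq> C"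
      by auto
    from C(2) obtain u where u: "u \<in> C" by fastforce
    have "C \<noteq> V" using C(2) Suc.prems by auto
    then obtain v where v: "v \<in> V" "v \<notin> C" using C(1) by auto
    have "(u, v) \<in> (adj E)\<^sup>*" using conn u v C(1) by (auto simp: connected_graph_iff)
    \<comment> \<open>A path that starts in \<open>C\<close> and ends outside must cross the
      boundary. The crossing edge is new, since all edges of \<open>E'\<close> stay inside
      \<open>C\<close>.\<close>
    then have "v \<notin> C \<longrightarrow> (\<exists>p q. p \<in> C \<and> q \<notin> C \<and> {p, q} \<in> E)"
    proof (induction rule: rtrancl_induct)
      case base
      then show ?case using u by simp
    next
      case (step y z)
      then show ?case by (auto simp: adj_def)
    qed
    with v obtain p q where pq: "p \<in> C" "q \<notin> C" "{p, q} \<in> E" by blast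
    have "{p, q} \<notin> E'" using pq E'(3) by auto
    moreover have "finite C" "finite E'"
      using C(1) E'(1) fin finite_subset by blast+
    moreover have "q \<in> V" using pq(3) sub by auto
    ultimately show ?case using C E' pq
      by (intro exI[of _ "insert q C"] exI[of _ "insert {p, q} E'"]) auto
  qed
  have "card V \<noteq> 0" using conn fin by (auto simp: connected_graph_iff)
  then obtain m where m: "card V = Suc m" using not0_implies_Suc by blast
  then obtain E' where "E' \<subseteq> E" "card E' = m" using grow[of m] by auto
  then show ?thesis using card_mono[OF fin(2)] m by auto
qed

definition conn_sum :: "'a :: comm_ring_1 \<Rightarrow> nat set \<Rightarrow> nat set \<Rightarrow> 'a" where
  "conn_sum t A B = (\<Sum>E | E \<subseteq> bedges A B \<and> connected_graph (bverts A B) E. t ^ card E)"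

text \<open>Edge sets are transported by the vertex map \<open>map_sum f g\<close> and back by its
  inverse. As \<open>f\<close> and \<open>g\<close> are invertible only on the given sets, every
  cancellation is checked on edges from \<open>bedges\<close>.\<close>

lemma conn_sum_relabel:
  assumes f: "bij_betw f A A'" and g: "bij_betw g B B'"
  shows "conn_sum t A B = conn_sum t A' B'"
proof -
  define f' where "f' = inv_into A f"
  define g' where "g' = inv_into B g"
  define h where "h = map_sum f g"
  define h' where "h' = map_sum f' g'"
  have f': "\<And>x. x \<in> A \<Longrightarrow> f' (f x) = x" "\<And>x. x \<in> A' \<Longrightarrow> f (f' x) = x" "f ` A = A'" "f' ` A' = A"
    unfolding f'_def using f bij_betw_inv_into_left[OF f] bij_betw_inv_into_right[OF f] bij_betw_inv_into[OF f]
    by (simp_all add: bij_betw_imp_surj_on)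
  have g': "\<And>x. x \<in> B \<Longrightarrow> g' (g x) = x" "\<And>x. x \<in> B' \<Longrightarrow> g (g' x) = x" "g ` B = B'" "g' ` B' = B"
    unfolding g'_def using g bij_betw_inv_into_left[OF g] bij_betw_inv_into_right[OF g] bij_betw_inv_into[OF g]
    by (simp_all add: bij_betw_imp_surj_on)
  have cancel: "(`) h2 ` (`) h1 ` E = E"
    if "E \<subseteq> bedges C D" "\<And>v. v \<in> bverts C D \<Longrightarrow> h2 (h1 v) = v" for C D E and h1 h2 :: "vertex \<Rightarrow> vertex"
  proof -
    have "h2 ` h1 ` e = e" if e: "e \<in> E" for e
    proof -
      obtain i j where "i \<in> C" "j \<in> D" "e = {Inl i, Inr j}"
        using e \<open>E \<subseteq> bedges C D\<close> by (rule bedgesE)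
      then show ?thesis
        using \<open>\<And>v. v \<in> bverts C D \<Longrightarrow> h2 (h1 v) = v\<close>[of "Inl i"]
          \<open>\<And>v. v \<in> bverts C D \<Longrightarrow> h2 (h1 v) = v\<close>[of "Inr j"] by (simp add: bverts_def)
    qed
    then show ?thesis by (force simp: image_image)
  qed
  have cancel_h: "v \<in> bverts A B \<Longrightarrow> h' (h v) = v" "v \<in> bverts A' B' \<Longrightarrow> h (h' v) = v" for v
    using f' g' by (auto simp: bverts_def h_def h'_def)
  have verts: "h ` bverts A B = bverts A' B'" "h' ` bverts A' B' = bverts A B"
    using f' g' by (auto simp: bverts_def h_def h'_def image_Un image_image)
  have edge: "h ` e \<in> bedges A' B'" if e: "e \<in> bedges A B" for e
  proof -
    obtain i j where "i \<in> A" "j \<in> B" "e = {Inl i, Inr j}" using e by (rule bedgesE[OF _ order.refl])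
    moreover from this have "f i \<in> A'" "g j \<in> B'" using f' g' by auto
    ultimately show ?thesis by (auto simp: bedges_iff h_def)
  qed
  have edge': "h' ` e \<in> bedges A B" if e: "e \<in> bedges A' B'" for e
  proof -
    obtain i j where "i \<in> A'" "j \<in> B'" "e = {Inl i, Inr j}" using e by (rule bedgesE[OF _ order.refl])
    moreover from this have "f' i \<in> A" "g' j \<in> B" using f' g' by auto
    ultimately show ?thesis by (auto simp: bedges_iff h'_def)
  qed
  have edges: "(`) h ` E \<subseteq> bedges A' B'" if "E \<subseteq> bedges A B" for E
    using that edge by blast
  have edges': "(`) h' ` E \<subseteq> bedges A B" if "E \<subseteq> bedges A' B'" for E
    using that edge' by blast
  have card: "card ((`) h ` E) = card E" if "E \<subseteq> bedges A B" for E
  proof -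
    have "h' ` h ` e = e" if "e \<in> bedges A B" for e
      using cancel[of "{e}" A B h' h] cancel_h that by simp
    then show ?thesis using that by (intro card_image inj_on_inverseI[of _ "(`) h'"]) blast
  qed
  show ?thesis
    unfolding conn_sum_def
  proof (rule sum.reindex_bij_witness[where i = "(`) ((`) h')" and j = "(`) ((`) h)"], goal_cases)
    case (1 E)
    then show ?case using cancel cancel_h by blast
  next
    case (2 E)
    then show ?case using edges connected_graph_image[of "bverts A B" E h] verts by auto
  next
    case (3 E)
    then show ?case using cancel cancel_h by blast
  next
    case (4 E)
    then show ?case using edges' connected_graph_image[of "bverts A' B'" E h'] verts by auto
  next
    case (5 E)
    then show ?case using card by simp
  qed
qed

lemma conn_sum_card:
  assumes "finite A" "finite B"
  shows "conn_sum t A B = conn_sum t {..<card A} {..<card B}"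
proof -
  obtain f where "bij_betw f A {..<card A}"
    using ex_bij_betw_finite_nat[OF assms(1)] by (auto simp: atLeast0LessThan)
  moreover obtain g where "bij_betw g B {..<card B}"
    using ex_bij_betw_finite_nat[OF assms(2)] by (auto simp: atLeast0LessThan)
  ultimately show ?thesis by (rule conn_sum_relabel)
qed

lemma sum_power_card_Pow:
  fixes t :: "'a :: comm_ring_1"
  assumes "finite S"
  shows "(\<Sum>E\<in>Pow S. t ^ card E) = (1 + t) ^ card S"
  using prod_add[OF assms, of "\<lambda>_. t" "\<lambda>_. 1"] by (simp add: add.commute)

lemma sum_Pow_card:
  fixes g :: "nat \<Rightarrow> 'a :: comm_semiring_1"
  assumes "finite S"
  shows "(\<Sum>X\<in>Pow S. g (card X)) = (\<Sum>i=0..card S. of_nat (card S choose i) * g i)"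
proof -
  have "(\<Sum>X\<in>Pow S. g (card X)) = (\<Sum>i=0..card S. \<Sum>X | X \<in> Pow S \<and> card X = i. g (card X))"
    using assms by (intro sum.group[symmetric]) (auto intro: card_mono)
  also have "\<dots> = (\<Sum>i=0..card S. of_nat (card S choose i) * g i)"
    using n_subsets[OF assms] by (intro sum.cong) (auto simp: )
  finally show ?thesis .
qed

section \<open>Splitting off the component of a root\<close>

definition comp_l :: "nat \<Rightarrow> nat set \<Rightarrow> vertex set set \<Rightarrow> nat set" where
  "comp_l a A E = {i \<in> A. (Inl a, Inl i) \<in> (adj E)\<^sup>*}"

definition comp_r :: "nat \<Rightarrow> nat set \<Rightarrow> vertex set set \<Rightarrow> nat set" where
  "comp_r a B E = {j \<in> B. (Inl a, Inr j) \<in> (adj E)\<^sup>*}"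

text \<open>An edge transmits reachability from the root in both directions, so its two ends lie
  both inside the component or both outside.\<close>

lemma bedges_split_component:
  assumes E: "E \<subseteq> bedges A B"
  shows "E = E \<inter> bedges (comp_l a A E) (comp_r a B E) \<union> E \<inter> bedges (A - comp_l a A E) (B - comp_r a B E)"
proof -
  have "e \<in> bedges (comp_l a A E) (comp_r a B E) \<or> e \<in> bedges (A - comp_l a A E) (B - comp_r a B E)"
    if "e \<in> E" for e
  proof -
    from that E obtain i j where ij: "i \<in> A" "j \<in> B" "e = {Inl i, Inr j}" by (rule bedgesE)
    have "(Inl i, Inr j) \<in> adj E" "(Inr j, Inl i) \<in> adj E"
      using that ij by (auto simp: adj_def insert_commute)
    then have "i \<in> comp_l a A E \<longleftrightarrow> j \<in> comp_r a B E"
      using ij unfolding comp_l_def comp_r_def by (blast intro: rtrancl_into_rtrancl)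
    then show ?thesis using ij by (auto simp: bedges_iff)
  qed
  then show ?thesis by blast
qed

lemma connected_component:
  assumes E: "E \<subseteq> bedges A B" and a: "a \<in> A"
  shows "connected_graph (bverts (comp_l a A E) (comp_r a B E)) (E \<inter> bedges (comp_l a A E) (comp_r a B E))"
    (is "connected_graph ?V ?E")
proof -
  have a_mem: "a \<in> comp_l a A E" using a by (simp add: comp_l_def)
  \<comment> \<open>Every vertex on a path from the root is itself reachable, so the path uses only
    edges within the component.\<close>
  have reach: "(Inl a, v) \<in> (adj ?E)\<^sup>*" if "(Inl a, v) \<in> (adj E)\<^sup>*" for v
    using that
  proof (induction rule: rtrancl_induct)
    case (step y z)
    then have e: "{y, z} \<in> E" and yz: "(Inl a, y) \<in> (adj E)\<^sup>*" "(Inl a, z) \<in> (adj E)\<^sup>*"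
      by (auto simp: adj_def intro: rtrancl_into_rtrancl)
    from e E obtain i j where ij: "i \<in> A" "j \<in> B" "{y, z} = {Inl i, Inr j}" by (rule bedgesE)
    then have "i \<in> comp_l a A E" "j \<in> comp_r a B E"
      using yz by (auto simp: comp_l_def comp_r_def doubleton_eq_iff)
    then have "(y, z) \<in> adj ?E" using e ij by (auto simp: adj_def bedges_iff)
    with step.IH show ?case by simp
  qed simp
  have "(Inl a, v) \<in> (adj ?E)\<^sup>*" if "v \<in> ?V" for v
    using that by (intro reach) (auto simp: bverts_def comp_l_def comp_r_def)
  then have "(u, v) \<in> (adj ?E)\<^sup>*" if "u \<in> ?V" "v \<in> ?V" for u v
    using rtrancl_trans[OF adj_rtrancl_sym[of "Inl a" u] , of ?E v] that by blast
  moreover have "?V \<noteq> {}" using a_mem by (auto simp: bverts_def)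
  ultimately show ?thesis by (simp add: connected_graph_iff)
qed

text \<open>This is the inverse of the decomposition: edges in the complement never touch
  \<open>A'\<close> and \<open>B'\<close>, so a walk from the root cannot leave them, and
  connectedness of \<open>E1\<close> makes it reach all of them.\<close>

lemma component_union:
  assumes A: "a \<in> A'" "A' \<subseteq> A" "B' \<subseteq> B"
    and E1: "E1 \<subseteq> bedges A' B'" "connected_graph (bverts A' B') E1"
    and E2: "E2 \<subseteq> bedges (A - A') (B - B')"
  shows "comp_l a A (E1 \<union> E2) = A'" "comp_r a B (E1 \<union> E2) = B'"
    "(E1 \<union> E2) \<inter> bedges A' B' = E1" "(E1 \<union> E2) \<inter> bedges (A - A') (B - B') = E2" "E1 \<inter> E2 = {}"
proof -
  have stay: "v \<in> bverts A' B'" if "(Inl a, v) \<in> (adj (E1 \<union> E2))\<^sup>*" for v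
    using that
  proof (induction rule: rtrancl_induct)
    case base
    then show ?case using A by (simp add: bverts_def)
  next
    case (step y z)
    from step(2) have "{y, z} \<in> E1 \<or> {y, z} \<in> E2" by (auto simp: adj_def)
    then show ?case
    proof
      assume "{y, z} \<in> E1"
      then show ?thesis using E1(1) by (fastforce simp: bedges_iff bverts_def doubleton_eq_iff)
    next
      assume "{y, z} \<in> E2"
      then show ?thesis using E2 step.IH by (fastforce simp: bedges_iff bverts_def doubleton_eq_iff)
    qed
  qed
  have reach: "(Inl a, v) \<in> (adj (E1 \<union> E2))\<^sup>*" if "v \<in> bverts A' B'" for v
  proof (rule adj_rtrancl_mono[of E1])
    have "Inl a \<in> bverts A' B'" using A by (simp add: bverts_def)
    then show "(Inl a, v) \<in> (adj E1)\<^sup>*" using E1(2) that unfolding connected_graph_iff by blast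
  qed simp
  show "comp_l a A (E1 \<union> E2) = A'" "comp_r a B (E1 \<union> E2) = B'"
    using stay[of "Inl _"] stay[of "Inr _"] reach[of "Inl _"] reach[of "Inr _"] A
    unfolding comp_l_def comp_r_def bverts_def by blast+
  have disj: "bedges A' B' \<inter> bedges (A - A') (B - B') = {}"
    by (auto simp: bedges_iff doubleton_eq_iff)
  show "(E1 \<union> E2) \<inter> bedges A' B' = E1" "(E1 \<union> E2) \<inter> bedges (A - A') (B - B') = E2" "E1 \<inter> E2 = {}"
    using disj E1(1) E2 by blast+
qed

text \<open>A graph corresponds to the vertex set of the root's component, a connected graph on it
  and an arbitrary graph on the rest. The weight \<open>t ^ card E\<close> is multiplicative because
  the two edge sets are disjoint.\<close>

lemma sum_graphs_root_component:
  fixes t :: "'a :: comm_ring_1"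
  assumes fin: "finite A" "finite B" and a: "a \<in> A"
  shows "(\<Sum>E\<in>Pow (bedges A B). t ^ card E) =
    (\<Sum>A' | A' \<subseteq> A \<and> a \<in> A'. \<Sum>B'\<in>Pow B. conn_sum t A' B' * (\<Sum>E\<in>Pow (bedges (A - A') (B - B')). t ^ card E))"
proof -
  define CG where "CG = (\<lambda>(A', B'). {E. E \<subseteq> bedges A' B' \<and> connected_graph (bverts A' B') E})"
  define RG where "RG = (\<lambda>(A', B'). Pow (bedges (A - A') (B - B')))"
  define P where "P = {A'. A' \<subseteq> A \<and> a \<in> A'} \<times> Pow B"
  have finP: "finite P" using fin by (simp add: P_def)
  have fin1: "finite (CG p)" "finite (RG p)" if p_mem: "p \<in> P" for p
  proof -
    obtain A' B' where p: "p = (A', B')" "A' \<subseteq> A" "B' \<subseteq> B" using p_mem by (auto simp: P_def)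
    then have "finite (Pow (bedges A' B'))" using fin by (simp add: finite_subset)
    then show "finite (CG p)" by (rule rev_finite_subset) (auto simp: CG_def p)
    show "finite (RG p)" using fin by (simp add: RG_def p)
  qed
  have "(\<Sum>A' | A' \<subseteq> A \<and> a \<in> A'. \<Sum>B'\<in>Pow B. conn_sum t A' B' * (\<Sum>E\<in>Pow (bedges (A - A') (B - B')). t ^ card E))
      = (\<Sum>p\<in>P. (\<Sum>E1\<in>CG p. t ^ card E1) * (\<Sum>E2\<in>RG p. t ^ card E2))"
    by (simp add: P_def CG_def RG_def conn_sum_def sum.cartesian_product case_prod_unfold)
  also have "\<dots> = (\<Sum>p\<in>P. \<Sum>(E1, E2)\<in>CG p \<times> RG p. t ^ card E1 * t ^ card E2)"
    by (simp add: sum_product sum.cartesian_product)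
  also have "\<dots> = (\<Sum>(p, E1, E2)\<in>(SIGMA p:P. CG p \<times> RG p). t ^ card E1 * t ^ card E2)"
    using finP fin1 by (subst sum.Sigma) (auto simp: case_prod_unfold)
  also have "\<dots> = (\<Sum>E\<in>Pow (bedges A B). t ^ card E)"
  proof (rule sum.reindex_bij_witness[where
        j = "\<lambda>(p, E1, E2). E1 \<union> E2" and
        i = "\<lambda>E. ((comp_l a A E, comp_r a B E), E \<inter> bedges (comp_l a A E) (comp_r a B E),
                  E \<inter> bedges (A - comp_l a A E) (B - comp_r a B E))"], goal_cases)
    case (1 x)
    then obtain A' B' E1 E2 where x: "x = ((A', B'), E1, E2)"
      and *: "a \<in> A'" "A' \<subseteq> A" "B' \<subseteq> B" "E1 \<subseteq> bedges A' B'" "connected_graph (bverts A' B') E1"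
        "E2 \<subseteq> bedges (A - A') (B - B')"
      by (auto simp: P_def CG_def RG_def)
    show ?case using component_union[OF *] by (simp add: x)
  next
    case (2 x)
    then show ?case by (fastforce simp: P_def CG_def RG_def bedges_iff)
  next
    case (3 E)
    then show ?case using bedges_split_component[of E A B a] by auto
  next
    case (4 E)
    then show ?case using connected_component[of E A B a] a
      by (auto simp: P_def CG_def RG_def comp_l_def comp_r_def)
  next
    case (5 x)
    then obtain A' B' E1 E2 where x: "x = ((A', B'), E1, E2)"
      and *: "a \<in> A'" "A' \<subseteq> A" "B' \<subseteq> B" "E1 \<subseteq> bedges A' B'" "connected_graph (bverts A' B') E1"
        "E2 \<subseteq> bedges (A - A') (B - B')"
      by (auto simp: P_def CG_def RG_def)
    have "finite A'" "finite B'" using finite_subset[OF *(2) fin(1)] finite_subset[OF *(3) fin(2)] .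
    then have "finite E1" "finite E2"
      using * fin by (auto intro: finite_subset[OF _ finite_bedges])
    then show ?case using component_union(5)[OF *]
      by (simp add: x card_Un_disjoint power_add)
  qed
  finally show ?thesis by simp
qed

definition conn_count :: "'a :: comm_ring_1 \<Rightarrow> nat \<Rightarrow> nat \<Rightarrow> 'a" where
  "conn_count t r s = conn_sum t {..<r} {..<s}"

lemma root_component_identity:
  fixes t :: "'a :: comm_ring_1"
  shows "(1 + t) ^ (Suc r * s) = (\<Sum>i=0..r. \<Sum>j=0..s. of_nat (r choose i) * of_nat (s choose j) *
    conn_count t (Suc i) j * (1 + t) ^ ((r - i) * (s - j)))"
proof -
  define g where "g = (\<lambda>i j. conn_count t (Suc i) j * (1 + t) ^ ((r - i) * (s - j)))"
  let ?A = "{..<Suc r}" and ?B = "{..<s}"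
  have "(1 + t) ^ (Suc r * s) = (\<Sum>E\<in>Pow (bedges ?A ?B). t ^ card E)"
    by (simp only: sum_power_card_Pow finite_bedges finite_lessThan card_bedges card_lessThan)
  also have "\<dots> = (\<Sum>A' | A' \<subseteq> ?A \<and> r \<in> A'. \<Sum>B'\<in>Pow ?B. conn_sum t A' B' * (\<Sum>E\<in>Pow (bedges (?A - A') (?B - B')). t ^ card E))"
    by (rule sum_graphs_root_component) auto
  also have "\<dots> = (\<Sum>X\<in>Pow {..<r}. \<Sum>B'\<in>Pow ?B. g (card X) (card B'))"
  \<comment> \<open>The root is the last left vertex \<open>r\<close>; without it, \<open>A'\<close>
    is an arbitrary subset of \<open>{..<r}\<close>.\<close>
  proof (rule sum.reindex_bij_witness[where i = "insert r" and j = "\<lambda>A'. A' - {r}"], goal_cases)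
    case (5 A')
    then have A': "A' \<subseteq> ?A" "r \<in> A'" "finite A'" using finite_subset by auto
    show ?case
    proof (rule sum.cong[OF refl])
      fix B' assume B': "B' \<in> Pow ?B"
      then have fB: "finite B'" using finite_subset by auto
      have cA: "card A' = Suc (card (A' - {r}))" using A' by (metis card.remove)
      show "g (card (A' - {r})) (card B') = conn_sum t A' B' * (\<Sum>E\<in>Pow (bedges (?A - A') (?B - B')). t ^ card E)"
        unfolding g_def conn_count_def conn_sum_card[OF A'(3) fB] cA
        using A' B' fB cA by (subst sum_power_card_Pow) (auto simp: card_bedges card_Diff_subset)
    qed
  qed (auto simp: less_Suc_eq)
  also have "\<dots> = (\<Sum>i=0..r. \<Sum>j=0..s. of_nat (r choose i) * (of_nat (s choose j) * g i j))"
    using sum_Pow_card[of "{..<r}" "\<lambda>i. \<Sum>B'\<in>Pow ?B. g i (card B')"] sum_Pow_card[of "{..<s}" "g _"]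
    by (simp add: sum_distrib_left[symmetric] )
  finally show ?thesis by (simp add: g_def mult.assoc)
qed

text \<open>With one side empty there are no edges, so only a single vertex is connected. This
  agrees with the convention in \<open>N_bi\<close>.\<close>

lemma conn_count_zero: "conn_count t 0 s = (if s = 1 then 1 else 0)"
  and conn_count_zero_right: "conn_count t r 0 = (if r = 1 then 1 else 0)"
proof -
  have "{E. E \<subseteq> bedges {..<0} {..<s} \<and> connected_graph (bverts {..<0} {..<s}) E} = (if s = 1 then {{}} else {})"
    by (cases s; cases "s - 1") (auto simp: bedges_def bverts_def connected_graph_iff adj_def lessThan_Suc)
  then show "conn_count t 0 s = (if s = 1 then 1 else 0)"
    by (simp add: conn_count_def conn_sum_def)
  have "{E. E \<subseteq> bedges {..<r} {..<0} \<and> connected_graph (bverts {..<r} {..<0}) E} = (if r = 1 then {{}} else {})"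
    by (cases r; cases "r - 1") (auto simp: bedges_def bverts_def connected_graph_iff adj_def lessThan_Suc)
  then show "conn_count t r 0 = (if r = 1 then 1 else 0)"
    by (simp add: conn_count_def conn_sum_def)
qed

text \<open>The extra factor \<open>fps_X\<close> turns the exponent r + s + k - 1 into r + s + k,
  which avoids truncated subtraction at r = s = 0. The lower bound on edges of connected graphs
  excludes smaller exponents.\<close>

lemma conn_count_N_bi:
  "fps_X * conn_count fps_X r s = fps_X ^ (r + s) * Abs_fps (\<lambda>k. of_nat (N_bi r s k) :: rat)"
proof (cases "r * s = 0")
  case True
  then consider "r = 0" | "s = 0" by auto
  then show ?thesis
  proof cases
    case 1
    have "Abs_fps (\<lambda>k. of_nat (N_bi 0 s k) :: rat) = (if s = 1 then 1 else 0)"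
      by (auto simp: fps_eq_iff N_bi_def)
    then show ?thesis by (cases "s = 1") (simp_all add: 1 conn_count_zero del: power_Suc)
  next
    case 2
    have "Abs_fps (\<lambda>k. of_nat (N_bi r 0 k) :: rat) = (if r = 1 then 1 else 0)"
      by (auto simp: fps_eq_iff N_bi_def)
    then show ?thesis by (cases "r = 1") (simp_all add: 2 conn_count_zero_right)
  qed
next
  case False
  define CG where "CG = {E. E \<subseteq> bedges {..<r} {..<s} \<and> connected_graph (bverts {..<r} {..<s}) E}"
  have finCG: "finite CG" by (rule finite_subset[of _ "Pow (bedges {..<r} {..<s})"]) (auto simp: CG_def)
  have N: "N_bi r s k = card {E \<in> CG. card E + 1 = r + s + k}" for k
    using False by (auto simp: N_bi_def CG_def complete_bip_edges_eq bip_verts_eq intro: arg_cong[where f = card])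
  have ge: "r + s \<le> card E + 1" if "E \<in> CG" for E
  proof -
    have "card (bverts {..<r} {..<s}) = r + s"
      unfolding bverts_def by (subst card_Un_disjoint) (auto simp: card_image)
    moreover have "\<Union>E \<subseteq> bverts {..<r} {..<s}" using that by (fastforce simp: CG_def bedges_iff bverts_def)
    moreover have "finite E" using that by (auto simp: CG_def intro: finite_subset[OF _ finite_bedges])
    moreover have "finite (bverts {..<r} {..<s})" by (simp add: bverts_def)
    ultimately show ?thesis using connected_graph_card_le[of "bverts {..<r} {..<s}" E] that
      by (simp add: CG_def)
  qed
  show ?thesis
  proof (rule fps_ext)
    fix m
    have "(fps_X * conn_count fps_X r s :: rat fps) $ m = (\<Sum>E\<in>CG. if card E + 1 = m then 1 else 0)"
      unfolding conn_count_def conn_sum_def CG_def[symmetric]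
      by (auto simp: sum_distrib_left fps_sum_nth power_Suc[symmetric] simp del: power_Suc intro!: sum.cong)
    also have "\<dots> = of_nat (card {E \<in> CG. card E + 1 = m})"
      using finCG by (simp add: sum.If_cases Int_def)
    also have "\<dots> = (fps_X ^ (r + s) * Abs_fps (\<lambda>k. of_nat (N_bi r s k))) $ m"
    proof (cases "m < r + s")
      case True
      then have "{E \<in> CG. card E + 1 = m} = {}" using ge by fastforce
      then show ?thesis using True by (simp only: card.empty) (simp add: fps_X_power_mult_nth)
    next
      case False
      then show ?thesis by (simp add: fps_X_power_mult_nth N)
    qed
    finally show "(fps_X * conn_count fps_X r s :: rat fps) $ m = (fps_X ^ (r + s) * Abs_fps (\<lambda>k. of_nat (N_bi r s k))) $ m" .
  qed
qed

subsection \<open>Generating functions with the edges marked by \<open>t\<close>\<close>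

text \<open>The hypothesis \<open>log\<close> expresses \<open>P = exp G\<close> up to a factor free
  of \<open>x\<close>. The defect \<open>\<delta> P - P * \<delta> G\<close> solves the same
  first-order equation in \<open>x\<close> as \<open>P\<close>, so it vanishes once its row
  \<open>x ^ 0\<close> does. This transfers the logarithmic relation to other derivations without
  forming an exponential.\<close>

lemma log_derivation_unique:
  fixes P G :: "'a :: {idom, semiring_char_0} fps fps"
  assumes mult: "\<And>A B. \<delta> (A * B) = \<delta> A * B + A * \<delta> B"
    and comm: "\<And>A. Dx (\<delta> A) = \<delta> (Dx A)"
    and log: "Dx P = P * Dx G"
    and row: "\<And>s. \<delta> P $ 0 $ s = (P * \<delta> G) $ 0 $ s"
  shows "\<delta> P = P * \<delta> G"
proof -
  have "\<delta> P - P * \<delta> G = 0"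
  proof (rule Dx_ode_unique[where B = "Dx G"])
    show "Dx (\<delta> P - P * \<delta> G) = Dx G * (\<delta> P - P * \<delta> G)"
      by (simp add: Dx_diff Dx_mult comm log mult algebra_simps)
  qed (simp_all add: row)
  then show ?thesis by simp
qed

text \<open>\<open>\<rat>[[t]][[y]][[x]]\<close>; in \<open>rescale\<close> below, \<open>x\<close> and \<open>y\<close> become \<open>t x\<close> and \<open>t y\<close>, which turns
  counting by edges into counting by excess; \<open>grow_y\<close> replaces \<open>y\<close> by \<open>(1 + t) y\<close>.\<close>

type_synonym fps3 = "rat fps fps fps"

abbreviation const3 :: "rat fps \<Rightarrow> fps3" where
  "const3 a \<equiv> fps_const (fps_const a)"

definition Dt :: "fps3 \<Rightarrow> fps3" where
  "Dt = coeffwise (\<lambda>r s a. fps_X * fps_deriv a)"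

definition grow_y :: "fps3 \<Rightarrow> fps3" where
  "grow_y = coeffwise (\<lambda>r s a. (1 + fps_X) ^ s * a)"

definition rescale :: "fps3 \<Rightarrow> fps3" where
  "rescale = coeffwise (\<lambda>r s a. fps_X ^ (r + s) * a)"

lemma Dt_nth [simp]: "Dt A $ r $ s = fps_X * fps_deriv (A $ r $ s)"
  and grow_y_nth [simp]: "grow_y A $ r $ s = (1 + fps_X) ^ s * A $ r $ s"
  and rescale_nth [simp]: "rescale A $ r $ s = fps_X ^ (r + s) * A $ r $ s"
  by (simp_all add: Dt_def grow_y_def rescale_def)

lemma Dt_mult: "Dt (A * B) = Dt A * B + A * Dt B"
  unfolding Dt_def by (rule coeffwise_mult_derivation) (simp_all add: algebra_simps)

lemma grow_y_mult: "grow_y (A * B) = grow_y A * grow_y B"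
  unfolding grow_y_def by (rule coeffwise_mult_hom) (simp_all add: algebra_simps power_add)

lemma rescale_mult: "rescale (A * B) = rescale A * rescale B"
  unfolding rescale_def by (rule coeffwise_mult_hom) (simp_all add: algebra_simps power_add)

lemma rescale_add: "rescale (A + B) = rescale A + rescale B"
  and rescale_diff: "rescale (A - B) = rescale A - rescale B"
  and rescale_const3: "rescale (const3 a * A) = const3 a * rescale A"
  and rescale_grow_y: "rescale (grow_y A) = grow_y (rescale A)"
  and rescale_Dx: "rescale (Dx A) = Dx (rescale A)"
  and rescale_Dy: "rescale (Dy A) = Dy (rescale A)"
  and grow_y_Dx: "grow_y (Dx A) = Dx (grow_y A)"
  and grow_y_Dy: "grow_y (Dy A) = Dy (grow_y A)"
  and grow_y_const3: "grow_y (const3 a * A) = const3 a * grow_y A"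
  and Dt_diff: "Dt (A - B) = Dt A - Dt B"
  and Dx_Dt: "Dx (Dt A) = Dt (Dx A)"
  and Dx_const3: "Dx (const3 a * A) = const3 a * Dx A"
  and Dy_const3: "Dy (const3 a * A) = const3 a * Dy A"
  by (rule fps2_eqI; simp add: algebra_simps fps_of_nat[symmetric])+

lemma fps_deriv_power_of_deriv_1:
  fixes u :: "rat fps"
  assumes "fps_deriv u = 1"
  shows "fps_deriv (u ^ Suc n) = of_nat (Suc n) * u ^ n"
  by (induction n) (simp_all add: assms algebra_simps)

lemma mult_fps_deriv_power_of_deriv_1:
  fixes u :: "rat fps"
  assumes "fps_deriv u = 1"
  shows "u * fps_deriv (u ^ n) = of_nat n * u ^ n"
proof (cases n)
  case (Suc m)
  then show ?thesis
    unfolding Suc fps_deriv_power_of_deriv_1[OF assms] by (simp add: mult_ac)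
qed simp

lemma rescale_inj: "rescale A = rescale B \<Longrightarrow> A = B"
proof (rule fps2_eqI)
  fix r s assume "rescale A = rescale B"
  then have "rescale A $ r $ s = rescale B $ r $ s" by simp
  then show "A $ r $ s = B $ r $ s" by (simp del: power_Suc)
qed

text \<open>Chain rule: after \<open>x\<close>, \<open>y\<close> become \<open>t x\<close>,
  \<open>t y\<close>, the derivation \<open>t d/dt\<close> also sees the total degree in
  \<open>x\<close> and \<open>y\<close>.\<close>

lemma Dt_rescale: "Dt (rescale A) = rescale (Dt A + Dx A + Dy A)"
proof (rule fps2_eqI)
  fix r s
  have "fps_X * fps_deriv (fps_X ^ n :: rat fps) = of_nat n * fps_X ^ n" for n
    by (rule mult_fps_deriv_power_of_deriv_1) simp
  then have "fps_X * fps_deriv (fps_X ^ (r + s) * A $ r $ s)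
      = fps_X ^ (r + s) * (fps_X * fps_deriv (A $ r $ s)) + of_nat (r + s) * fps_X ^ (r + s) * A $ r $ s"
    by (simp only: fps_deriv_mult distrib_left mult.assoc[symmetric]) (simp add: mult_ac)
  then show "Dt (rescale A) $ r $ s = rescale (Dt A + Dx A + Dy A) $ r $ s"
    by (simp add: algebra_simps)
qed

definition graph_ser :: fps3 where
  "graph_ser = Abs_fps (\<lambda>r. Abs_fps (\<lambda>s. fps_const (1 / (fact r * fact s)) * (1 + fps_X) ^ (r * s)))"

definition conn_ser :: fps3 where
  "conn_ser = Abs_fps (\<lambda>r. Abs_fps (\<lambda>s. fps_const (1 / (fact r * fact s)) * conn_count fps_X r s))"

text \<open>The series \<open>\<Sum> t ^ k * F k\<close>, with the exponent of \<open>t\<close> now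
  the Betti number.\<close>

definition excess_ser :: fps3 where
  "excess_ser = Abs_fps (\<lambda>r. Abs_fps (\<lambda>s. fps_const (1 / (fact r * fact s)) * Abs_fps (\<lambda>k. of_nat (N_bi r s k))))"

lemma graph_ser_nth: "graph_ser $ r $ s = fps_const (1 / (fact r * fact s)) * (1 + fps_X) ^ (r * s)"
  and conn_ser_nth: "conn_ser $ r $ s = fps_const (1 / (fact r * fact s)) * conn_count fps_X r s"
  and excess_ser_nth: "excess_ser $ r $ s = fps_const (1 / (fact r * fact s)) * Abs_fps (\<lambda>k. of_nat (N_bi r s k))"
  by (simp_all add: graph_ser_def conn_ser_def excess_ser_def)

lemma graph_ser_nonzero: "graph_ser \<noteq> 0"
proof
  assume "graph_ser = 0"
  then have "graph_ser $ 0 $ 0 = 0" by simp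
  then show False by (simp add: graph_ser_nth)
qed

lemma rescale_excess_ser: "rescale excess_ser = const3 fps_X * conn_ser"
proof (rule fps2_eqI)
  fix r s
  have "rescale excess_ser $ r $ s = fps_const (1 / (fact r * fact s)) * (fps_X ^ (r + s) * Abs_fps (\<lambda>k. of_nat (N_bi r s k)))"
    by (simp add: excess_ser_nth algebra_simps)
  also have "\<dots> = fps_const (1 / (fact r * fact s)) * (fps_X * conn_count fps_X r s)"
    by (simp only: conn_count_N_bi)
  finally show "rescale excess_ser $ r $ s = (const3 fps_X * conn_ser) $ r $ s"
    by (simp add: conn_ser_nth algebra_simps)
qed

text \<open>This is \<open>P = exp G\<close> in differentiated form. The factor \<open>r\<close>
  produced by \<open>Dx\<close> turns \<open>1 / r!\<close> into \<open>1 / (r - 1)!\<close>, and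
  the factorials then absorb the binomials of \<open>root_component_identity\<close>.\<close>

lemma Dx_graph_ser: "Dx graph_ser = graph_ser * Dx conn_ser"
proof (rule fps2_eqI)
  fix r s
  show "Dx graph_ser $ r $ s = (graph_ser * Dx conn_ser) $ r $ s"
  proof (cases r)
    case 0
    then show ?thesis by (simp only: fps2_mult_nth) simp
  next
    case (Suc m)
    define c :: "rat \<Rightarrow> rat fps" where "c = fps_const"
    have coeff: "of_nat (Suc i) * (c (1 / (fact (Suc i) * fact j)) * C) * (c (1 / (fact (m - i) * fact (s - j))) * D)
        = c (1 / (fact m * fact s)) * (of_nat (m choose i) * of_nat (s choose j) * C * D)"
      if "i \<le> m" "j \<le> s" for i j and C D :: "rat fps"
    proof -
      have "of_nat (Suc i) * c (1 / (fact (Suc i) * fact j)) * c (1 / (fact (m - i) * fact (s - j)))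
          = c (of_nat (Suc i) * (1 / (fact (Suc i) * fact j)) * (1 / (fact (m - i) * fact (s - j))))"
        by (simp only: c_def fps_of_nat[symmetric] fps_const_mult)
      also have "of_nat (Suc i) * (1 / (fact (Suc i) * fact j)) * (1 / (fact (m - i) * fact (s - j)))
          = (1 / (fact m * fact s)) * (of_nat (m choose i) * of_nat (s choose j) :: rat)"
        using that by (simp add: binomial_fact divide_simps del: of_nat_Suc)
      also have "c \<dots> = c (1 / (fact m * fact s)) * (of_nat (m choose i) * of_nat (s choose j))"
        by (simp only: c_def fps_of_nat[symmetric] fps_const_mult)
      finally show ?thesis by (simp add: mult_ac)
    qed
    have "(graph_ser * Dx conn_ser) $ Suc m $ s = (Dx conn_ser * graph_ser) $ Suc m $ s" by (simp add: mult.commute)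
    also have "\<dots> = (\<Sum>i=0..m. \<Sum>j=0..s. of_nat (Suc i) * (c (1 / (fact (Suc i) * fact j)) * conn_count fps_X (Suc i) j)
        * (c (1 / (fact (m - i) * fact (s - j))) * (1 + fps_X) ^ ((m - i) * (s - j))))"
      unfolding fps2_mult_nth c_def
      by (subst sum.atLeast0_atMost_Suc_shift) (simp add: conn_ser_nth graph_ser_nth del: fact_Suc)
    also have "\<dots> = (\<Sum>i=0..m. \<Sum>j=0..s. c (1 / (fact m * fact s)) * (of_nat (m choose i) * of_nat (s choose j) *
        conn_count fps_X (Suc i) j * (1 + fps_X) ^ ((m - i) * (s - j))))"
      by (intro sum.cong refl coeff) auto
    also have "\<dots> = c (1 / (fact m * fact s)) * (1 + fps_X) ^ (Suc m * s)"
      by (simp only: sum_distrib_left[symmetric] root_component_identity[symmetric])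
    also have "\<dots> = Dx graph_ser $ Suc m $ s"
    proof -
      have "c (1 / (fact m * fact s)) = c (of_nat (Suc m) * (1 / (fact (Suc m) * fact s)))"
        by (simp add: divide_simps del: of_nat_Suc)
      also have "\<dots> = of_nat (Suc m) * c (1 / (fact (Suc m) * fact s))"
        by (simp only: c_def fps_of_nat[symmetric] fps_const_mult)
      finally show ?thesis by (simp only: Dx_nth graph_ser_nth c_def mult.assoc)
    qed
    finally show ?thesis by (simp add: Suc)
  qed
qed

lemma conn_ser_row_zero: "conn_ser $ 0 $ s = (if s = 1 then 1 else 0)"
  by (simp add: conn_ser_nth conn_count_zero)

lemma conn_ser_col_zero: "conn_ser $ r $ 0 = (if r = 1 then 1 else 0)"
  by (simp add: conn_ser_nth conn_count_zero_right)

lemma Dx_grow_y_graph_ser: "Dx (grow_y graph_ser) = grow_y graph_ser * Dx (grow_y conn_ser)"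
  by (simp only: grow_y_Dx[symmetric] Dx_graph_ser grow_y_mult)

text \<open>Meant for derivatives of the connected series, whose row \<open>x ^ 0\<close> is at most
  a multiple of \<open>y\<close>: without left vertices only one isolated right vertex is
  connected.\<close>

lemma mult_row_zero_single:
  fixes A B :: "'a :: comm_ring_1 fps fps"
  assumes "\<And>j. j \<noteq> 1 \<Longrightarrow> B $ 0 $ j = 0"
  shows "(A * B) $ 0 $ s = (case s of 0 \<Rightarrow> 0 | Suc n \<Rightarrow> A $ 0 $ n * B $ 0 $ 1)"
proof -
  have "(A * B) $ 0 $ s = (\<Sum>j=0..s. B $ 0 $ j * A $ 0 $ (s - j))"
    by (subst mult.commute) (simp only: fps2_mult_nth, simp)
  also have "\<dots> = (\<Sum>j=0..s. if j = 1 then B $ 0 $ 1 * A $ 0 $ (s - 1) else 0)"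
    by (intro sum.cong) (auto simp: assms)
  finally show ?thesis by (cases s) (simp_all add: mult.commute)
qed

lemma fact_Suc_inverse: "of_nat (Suc n) * (1 / fact (Suc n)) = (1 / fact n :: rat)"
  by (simp add: divide_simps del: of_nat_Suc)

lemma Dy_graph_ser: "Dy graph_ser = graph_ser * Dy conn_ser"
proof (rule log_derivation_unique[where \<delta> = Dy, OF Dy_mult Dx_Dy_commute Dx_graph_ser])
  fix s
  have "Dy conn_ser $ 0 $ j = 0" if "j \<noteq> 1" for j using that by (simp add: conn_ser_row_zero)
  then have "(graph_ser * Dy conn_ser) $ 0 $ s = (case s of 0 \<Rightarrow> 0 | Suc n \<Rightarrow> graph_ser $ 0 $ n * Dy conn_ser $ 0 $ 1)"
    by (rule mult_row_zero_single)
  moreover have "of_nat (Suc n) * fps_const (1 / fact (Suc n)) = (fps_const (1 / fact n) :: rat fps)" for n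
    by (simp only: fps_of_nat[symmetric] fps_const_mult fact_Suc_inverse)
  ultimately show "Dy graph_ser $ 0 $ s = (graph_ser * Dy conn_ser) $ 0 $ s"
    by (cases s) (simp_all add: graph_ser_nth conn_ser_row_zero del: of_nat_Suc fact_Suc)
qed

lemma Dt_graph_ser: "Dt graph_ser = graph_ser * Dt conn_ser"
proof (rule log_derivation_unique[where \<delta> = Dt, OF Dt_mult Dx_Dt Dx_graph_ser])
  fix s
  have zero: "Dt conn_ser $ 0 $ j = 0" for j by (simp add: conn_ser_row_zero)
  have "(graph_ser * Dt conn_ser) $ 0 $ s = 0"
    unfolding mult_row_zero_single[of "Dt conn_ser" graph_ser s, OF zero] by (cases s) (simp_all only: nat.case zero mult_zero_right)
  then show "Dt graph_ser $ 0 $ s = (graph_ser * Dt conn_ser) $ 0 $ s" by (simp add: graph_ser_nth)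
qed

lemma Dt_grow_y_graph_ser: "Dt (grow_y graph_ser) = grow_y graph_ser * Dt (grow_y conn_ser)"
proof (rule log_derivation_unique[where \<delta> = Dt, OF Dt_mult Dx_Dt Dx_grow_y_graph_ser])
  fix s
  have "Dt (grow_y conn_ser) $ 0 $ j = 0" if "j \<noteq> 1" for j using that by (simp add: conn_ser_row_zero)
  then have "(grow_y graph_ser * Dt (grow_y conn_ser)) $ 0 $ s = (case s of 0 \<Rightarrow> 0 | Suc n \<Rightarrow> grow_y graph_ser $ 0 $ n * Dt (grow_y conn_ser) $ 0 $ 1)"
    by (rule mult_row_zero_single)
  moreover have "fps_const (1 / fact (Suc n)) * fps_deriv ((1 + fps_X) ^ Suc n)
      = (fps_const (1 / fact n) * (1 + fps_X) ^ n :: rat fps)" for n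
  proof -
    have "fps_const (1 / fact (Suc n)) * fps_deriv ((1 + fps_X) ^ Suc n)
        = (of_nat (Suc n) * fps_const (1 / fact (Suc n)) * (1 + fps_X) ^ n :: rat fps)"
      by (subst fps_deriv_power_of_deriv_1) (simp_all add: mult_ac del: of_nat_Suc fact_Suc)
    also have "of_nat (Suc n) * fps_const (1 / fact (Suc n)) = (fps_const (1 / fact n) :: rat fps)"
      by (simp only: fps_of_nat[symmetric] fps_const_mult fact_Suc_inverse)
    finally show ?thesis .
  qed
  ultimately show "Dt (grow_y graph_ser) $ 0 $ s = (grow_y graph_ser * Dt (grow_y conn_ser)) $ 0 $ s"
    by (cases s) (simp_all add: graph_ser_nth conn_ser_row_zero mult_ac del: of_nat_Suc fact_Suc power_Suc)
qed

text \<open>On \<open>(1 + t) ^ (r s)\<close> the operator \<open>(1 + t) d/dt\<close> acts as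
  multiplication by \<open>r s\<close>, and so does \<open>D_x D_y\<close> on
  \<open>x ^ r y ^ s\<close>.\<close>

lemma edge_weight_graph_ser: "const3 (1 + fps_X) * Dt graph_ser = const3 fps_X * Dx (Dy graph_ser)"
proof (rule fps2_eqI)
  fix r s
  have "(1 + fps_X) * fps_deriv ((1 + fps_X) ^ n :: rat fps) = of_nat n * (1 + fps_X) ^ n" for n
    by (rule mult_fps_deriv_power_of_deriv_1) simp
  from this[of "r * s"] show "(const3 (1 + fps_X) * Dt graph_ser) $ r $ s = (const3 fps_X * Dx (Dy graph_ser)) $ r $ s"
    by (simp add: graph_ser_nth mult_ac)
qed

lemma PDE_conn_ser: "const3 (1 + fps_X) * Dt conn_ser = const3 fps_X * (Dx (Dy conn_ser) + Dx conn_ser * Dy conn_ser)"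
proof -
  have "graph_ser * (const3 (1 + fps_X) * Dt conn_ser) = graph_ser * (const3 fps_X * (Dx (Dy conn_ser) + Dx conn_ser * Dy conn_ser))"
    using edge_weight_graph_ser by (simp add: Dt_graph_ser Dy_graph_ser Dx_graph_ser Dx_mult algebra_simps)
  then show ?thesis using graph_ser_nonzero by simp
qed

text \<open>The exponent splits as \<open>r s = (r - 1) s + s\<close>, and the last summand is the
  substitution \<open>y -> (1 + t) y\<close>. Dividing by \<open>P\<close> gives
  \<open>D_x G = x exp (G(x, (1 + t) y) - G(x, y))\<close>.\<close>

lemma root_graph_ser: "graph_ser * Dx conn_ser = fps_X * grow_y graph_ser"
proof (rule fps2_eqI)
  fix r s
  show "(graph_ser * Dx conn_ser) $ r $ s = (fps_X * grow_y graph_ser) $ r $ s"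
  proof (cases r)
    case (Suc m)
    have "of_nat (Suc m) * fps_const (1 / (fact (Suc m) * fact s)) = (fps_const (1 / (fact m * fact s)) :: rat fps)"
      by (simp only: fps_of_nat[symmetric] fps_const_mult) (simp add: divide_simps del: of_nat_Suc)
    then have "Dx graph_ser $ Suc m $ s = (fps_X * grow_y graph_ser) $ Suc m $ s"
      by (simp add: graph_ser_nth power_add mult_ac del: of_nat_Suc fact_Suc)
    then show ?thesis by (simp only: Dx_graph_ser Suc)
  qed (simp add: Dx_graph_ser[symmetric])
qed

text \<open>Logarithmic derivative of the root equation. The parameter \<open>e\<close> is the
  logarithmic derivative of \<open>x\<close>: 1 for \<open>Dx\<close>, 0 for \<open>Dy\<close> and
  \<open>Dt\<close>.\<close>

lemma root_derivation:
  assumes mult: "\<And>A B. \<delta> (A * B) = \<delta> A * B + A * \<delta> B"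
    and X: "\<delta> fps_X = e * fps_X"
    and graph_ser: "\<delta> graph_ser = graph_ser * \<delta> conn_ser" and grow_y_graph_ser: "\<delta> (grow_y graph_ser) = grow_y graph_ser * \<delta> (grow_y conn_ser)"
  shows "\<delta> (Dx conn_ser) = Dx conn_ser * (e + \<delta> (grow_y conn_ser) - \<delta> conn_ser)"
proof -
  have "\<delta> (graph_ser * Dx conn_ser) = graph_ser * (\<delta> conn_ser * Dx conn_ser + \<delta> (Dx conn_ser))"
    by (simp add: mult graph_ser algebra_simps)
  moreover have "\<delta> (graph_ser * Dx conn_ser) = fps_X * grow_y graph_ser * (e + \<delta> (grow_y conn_ser))"
    unfolding root_graph_ser by (simp add: mult X grow_y_graph_ser algebra_simps)
  ultimately have "graph_ser * (\<delta> conn_ser * Dx conn_ser + \<delta> (Dx conn_ser)) = graph_ser * (Dx conn_ser * (e + \<delta> (grow_y conn_ser)))"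
    by (simp only: root_graph_ser[symmetric] mult.assoc)
  then have "\<delta> conn_ser * Dx conn_ser + \<delta> (Dx conn_ser) = Dx conn_ser * (e + \<delta> (grow_y conn_ser))" using graph_ser_nonzero by simp
  then show ?thesis by (simp add: algebra_simps)
qed

text \<open>The quotient \<open>((1 + t) ^ s - 1) / t\<close> is written as a geometric sum. After
  rescaling this is the exponent \<open>G(x, (1 + t) y) - G(x, y)\<close> of the root
  equation.\<close>

definition root_ser :: fps3 where
  "root_ser = coeffwise (\<lambda>r s a. (\<Sum>i<s. (1 + fps_X) ^ i) * a) excess_ser"

lemma rescale_root_ser: "rescale root_ser = grow_y conn_ser - conn_ser"
proof -
  have "const3 fps_X * root_ser = grow_y excess_ser - excess_ser"
  proof (rule fps2_eqI)
    fix r s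
    have "fps_X * (\<Sum>i<s. (1 + fps_X) ^ i) = (1 + fps_X) ^ s - (1 :: rat fps)"
      using power_diff_1_eq[of "1 + fps_X :: rat fps" s] by simp
    then have "fps_X * ((\<Sum>i<s. (1 + fps_X) ^ i) * excess_ser $ r $ s) = ((1 + fps_X) ^ s - 1) * excess_ser $ r $ s"
      by (simp only: mult.assoc[symmetric])
    then show "(const3 fps_X * root_ser) $ r $ s = (grow_y excess_ser - excess_ser) $ r $ s"
      by (simp add: root_ser_def algebra_simps)
  qed
  then have "const3 fps_X * rescale root_ser = const3 fps_X * (grow_y conn_ser - conn_ser)"
    by (simp only: rescale_const3[symmetric] rescale_diff rescale_grow_y rescale_excess_ser grow_y_const3 right_diff_distrib)
  then show ?thesis by simp
qed

lemma rescale_Dx_excess_ser: "rescale (Dx excess_ser) = const3 fps_X * Dx conn_ser"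
  by (simp add: rescale_Dx rescale_excess_ser Dx_const3)

lemma Dx_Dx_excess_ser: "Dx (Dx excess_ser) = Dx excess_ser * (1 + Dx root_ser)"
proof (rule rescale_inj)
  have "Dx (Dx conn_ser) = Dx conn_ser * (1 + Dx (grow_y conn_ser) - Dx conn_ser)"
    by (rule root_derivation[where \<delta> = Dx, OF Dx_mult _ Dx_graph_ser Dx_grow_y_graph_ser]) (rule fps2_eqI, simp)
  then have "Dx (rescale (Dx excess_ser)) = rescale (Dx excess_ser) * (1 + Dx (rescale root_ser))"
    by (simp only: rescale_Dx_excess_ser Dx_const3 rescale_root_ser Dx_diff) (simp add: algebra_simps)
  moreover have "rescale 1 = 1" by (rule fps2_eqI) auto
  ultimately show "rescale (Dx (Dx excess_ser)) = rescale (Dx excess_ser * (1 + Dx root_ser))"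
    by (simp add: rescale_Dx rescale_mult rescale_add)
qed

lemma Dy_grow_y_graph_ser: "Dy (grow_y graph_ser) = grow_y graph_ser * Dy (grow_y conn_ser)"
  by (simp only: grow_y_Dy[symmetric] Dy_graph_ser grow_y_mult)

lemma Dy_Dx_excess_ser: "Dy (Dx excess_ser) = Dx excess_ser * Dy root_ser"
proof (rule rescale_inj)
  have "Dy (Dx conn_ser) = Dx conn_ser * (0 + Dy (grow_y conn_ser) - Dy conn_ser)"
    by (rule root_derivation[where \<delta> = Dy, OF Dy_mult _ Dy_graph_ser Dy_grow_y_graph_ser]) (rule fps2_eqI, simp)
  then have "Dy (rescale (Dx excess_ser)) = rescale (Dx excess_ser) * Dy (rescale root_ser)"
    by (simp only: rescale_Dx_excess_ser Dy_const3 rescale_root_ser Dy_diff) (simp add: algebra_simps)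
  then show "rescale (Dy (Dx excess_ser)) = rescale (Dx excess_ser * Dy root_ser)"
    by (simp add: rescale_Dy rescale_mult)
qed

lemma Dt_const3_X: "Dt (const3 fps_X * A) = const3 fps_X * (A + Dt A)"
  by (rule fps2_eqI) (simp add: algebra_simps)

text \<open>Rescaling adds the \<open>Dx\<close> and \<open>Dy\<close> parts of the chain rule on
  both sides; the two preceding identities cancel them.\<close>

lemma Dt_Dx_excess_ser: "Dt (Dx excess_ser) = Dx excess_ser * Dt root_ser"
proof -
  have "Dt (Dx conn_ser) = Dx conn_ser * (0 + Dt (grow_y conn_ser) - Dt conn_ser)"
    by (rule root_derivation[where \<delta> = Dt, OF Dt_mult _ Dt_graph_ser Dt_grow_y_graph_ser]) (rule fps2_eqI, simp)
  then have "Dt (rescale (Dx excess_ser)) = rescale (Dx excess_ser) * (1 + Dt (rescale root_ser))"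
    by (simp only: rescale_Dx_excess_ser Dt_const3_X rescale_root_ser Dt_diff) (simp add: algebra_simps)
  moreover have "rescale 1 = 1" by (rule fps2_eqI) auto
  ultimately have "rescale (Dt (Dx excess_ser) + Dx (Dx excess_ser) + Dy (Dx excess_ser)) = rescale (Dx excess_ser * (1 + (Dt root_ser + Dx root_ser + Dy root_ser)))"
    by (simp add: Dt_rescale rescale_mult rescale_add)
  then have "Dt (Dx excess_ser) + Dx (Dx excess_ser) + Dy (Dx excess_ser) = Dx excess_ser * (1 + (Dt root_ser + Dx root_ser + Dy root_ser))"
    by (rule rescale_inj)
  then show ?thesis by (simp add: Dx_Dx_excess_ser Dy_Dx_excess_ser algebra_simps)
qed

lemma PDE_excess_ser:
  "const3 (1 + fps_X) * (Dt excess_ser + Dx excess_ser + Dy excess_ser - excess_ser) = const3 fps_X * Dx (Dy excess_ser) + Dx excess_ser * Dy excess_ser"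
proof (rule rescale_inj)
  have "rescale (Dt excess_ser + Dx excess_ser + Dy excess_ser - excess_ser) = const3 fps_X * Dt conn_ser"
    by (simp only: rescale_diff Dt_rescale[symmetric] rescale_excess_ser Dt_const3_X) (simp add: algebra_simps)
  then have "rescale (const3 (1 + fps_X) * (Dt excess_ser + Dx excess_ser + Dy excess_ser - excess_ser)) = const3 fps_X * (const3 (1 + fps_X) * Dt conn_ser)"
    by (simp only: rescale_const3 mult.left_commute)
  also have "\<dots> = rescale (const3 fps_X * Dx (Dy excess_ser) + Dx excess_ser * Dy excess_ser)"
    by (simp only: PDE_conn_ser) (simp only: rescale_add rescale_mult[of "Dx excess_ser" "Dy excess_ser"] rescale_const3 rescale_Dx rescale_Dy rescale_excess_ser Dx_const3 Dy_const3, simp only: distrib_left mult_ac)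
  finally show "rescale (const3 (1 + fps_X) * (Dt excess_ser + Dx excess_ser + Dy excess_ser - excess_ser)) = rescale (const3 fps_X * Dx (Dy excess_ser) + Dx excess_ser * Dy excess_ser)" .
qed

text \<open>Symmetry is read off the series instead of a bijection of graphs:
  \<open>graph_ser\<close> is visibly symmetric and determines \<open>Dx conn_ser\<close>. Row 0,
  which \<open>Dx\<close> does not see, is known explicitly.\<close>

lemma swap_conn_ser: "conn_ser $ s $ r = conn_ser $ r $ s"
proof (cases "r = 0")
  case True
  then show ?thesis by (simp add: conn_ser_row_zero conn_ser_col_zero)
next
  case False
  have graph_ser: "fps2_swap graph_ser = graph_ser"
    by (rule fps2_eqI) (simp add: graph_ser_nth mult.commute)
  have "graph_ser * Dx (fps2_swap conn_ser) = fps2_swap (graph_ser * Dy conn_ser)"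
    by (simp only: fps2_swap_mult graph_ser swap_Dy)
  also have "\<dots> = graph_ser * Dx conn_ser" by (simp only: Dy_graph_ser[symmetric] swap_Dy graph_ser Dx_graph_ser)
  finally have "Dx (fps2_swap conn_ser) $ r $ s = Dx conn_ser $ r $ s" using graph_ser_nonzero by simp
  then show ?thesis using False by simp
qed

lemma N_bi_commute: "N_bi r s k = N_bi s r k"
proof -
  have "fps_X ^ (r + s) * excess_ser $ r $ s = fps_X ^ (r + s) * excess_ser $ s $ r"
    using arg_cong[OF rescale_excess_ser, of "\<lambda>A. A $ r $ s"] arg_cong[OF rescale_excess_ser, of "\<lambda>A. A $ s $ r"] swap_conn_ser[of r s]
    by (simp add: add.commute)
  then have "excess_ser $ r $ s = excess_ser $ s $ r" by simp
  then have "excess_ser $ r $ s $ k = excess_ser $ s $ r $ k" by simp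
  then show ?thesis by (simp add: excess_ser_nth mult.commute)
qed

lemma swap_F: "fps2_swap (F k) = F k"
  by (rule fps2_eqI) (simp add: F_def N_bi_commute[of _ _ k] mult.commute)

section \<open>Comparing coefficients of powers of \<open>t\<close>\<close>

definition excess_part :: "nat \<Rightarrow> fps3 \<Rightarrow> fps2" where
  "excess_part k = coeffwise (\<lambda>r s a. a $ k)"

lemma excess_part_nth [simp]: "excess_part k A $ r $ s = A $ r $ s $ k"
  by (simp add: excess_part_def)

lemma excess_part_mult: "excess_part k (A * B) = (\<Sum>i=0..k. excess_part i A * excess_part (k - i) B)"
proof (rule fps2_eqI)
  fix r s
  have "excess_part k (A * B) $ r $ s =
    (\<Sum>p=0..r. \<Sum>q=0..s. \<Sum>i=0..k. A $ p $ q $ i * B $ (r - p) $ (s - q) $ (k - i))"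
    by (simp add: fps2_mult_nth fps_sum_nth fps_mult_nth)
  also have "\<dots> = (\<Sum>p=0..r. \<Sum>i=0..k. \<Sum>q=0..s. A $ p $ q $ i * B $ (r - p) $ (s - q) $ (k - i))"
    by (intro sum.cong refl sum.swap)
  also have "\<dots> = (\<Sum>i=0..k. \<Sum>p=0..r. \<Sum>q=0..s. A $ p $ q $ i * B $ (r - p) $ (s - q) $ (k - i))"
    by (rule sum.swap)
  also have "\<dots> = (\<Sum>i=0..k. excess_part i A * excess_part (k - i) B) $ r $ s"
    by (simp add: fps_sum_nth fps2_mult_nth)
  finally show "excess_part k (A * B) $ r $ s = (\<Sum>i=0..k. excess_part i A * excess_part (k - i) B) $ r $ s" .
qed

lemma of_nat_fps2_mult_nth: "(of_nat n * A) $ r $ s = of_nat n * A $ r $ s"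
  for A :: "'a :: comm_ring_1 fps fps"
  by (simp add: fps_of_nat[symmetric])

lemma excess_part_add: "excess_part k (A + B) = excess_part k A + excess_part k B"
  and excess_part_diff: "excess_part k (A - B) = excess_part k A - excess_part k B"
  and excess_part_Dx: "excess_part k (Dx A) = Dx (excess_part k A)"
  and excess_part_Dy: "excess_part k (Dy A) = Dy (excess_part k A)"
  and excess_part_Dt: "excess_part k (Dt A) = of_nat k * excess_part k A"
  by (rule fps2_eqI; simp add: fps_of_nat[symmetric]; cases k; simp add: fps_of_nat[symmetric])+

lemma excess_part_const3_X: "excess_part (Suc k) (const3 fps_X * A) = excess_part k A"
  and excess_part_const3_1_X: "excess_part (Suc k) (const3 (1 + fps_X) * A) = excess_part (Suc k) A + excess_part k A"
  by (rule fps2_eqI; simp add: algebra_simps)+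

lemma excess_ser_nth_nth: "excess_ser $ r $ s $ k = F k $ r $ s"
  by (simp add: excess_ser_nth F_def)

lemma excess_part_excess_ser: "excess_part k excess_ser = F k"
  by (rule fps2_eqI) (simp add: excess_ser_nth_nth)

text \<open>The binomial \<open>D_y (D_y - 1) ... (D_y - m + 1) / m!\<close>, which is the
  coefficient of \<open>t ^ m\<close> in the substitution \<open>y -> (1 + t) y\<close>.\<close>

definition Dy_choose :: "nat \<Rightarrow> fps2 \<Rightarrow> fps2" where
  "Dy_choose m = coeffwise (\<lambda>r s a. of_nat (s choose m) * a)"

lemma Dy_choose_nth [simp]: "Dy_choose m A $ r $ s = of_nat (s choose m) * A $ r $ s"
  by (simp add: Dy_choose_def)

lemma Dy_choose_Suc: "of_nat (Suc m) * Dy_choose (Suc m) A = Dy (Dy_choose m A) - of_nat m * Dy_choose m A"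
proof (rule fps2_eqI)
  fix r s
  have "of_nat (Suc m) * of_nat (s choose Suc m) = (of_nat s - of_nat m) * (of_nat (s choose m) :: rat)"
  proof (cases "m \<le> s")
    case True
    have "Suc m * (s choose Suc m) = (s - m) * (s choose m)"
      by (metis binomial_absorb_comp binomial_absorption mult.commute)
    then show ?thesis using True by (metis of_nat_diff of_nat_mult)
  qed (simp add: binomial_eq_0)
  then have "of_nat (Suc m) * (of_nat (s choose Suc m) * A $ r $ s) = (of_nat s - of_nat m) * (of_nat (s choose m) :: rat) * A $ r $ s"
    by (simp only: mult.assoc[symmetric])
  then show "(of_nat (Suc m) * Dy_choose (Suc m) A) $ r $ s = (Dy (Dy_choose m A) - of_nat m * Dy_choose m A) $ r $ s"
    by (simp add: of_nat_fps2_mult_nth algebra_simps del: of_nat_Suc)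
qed

lemma one_plus_X_power_nth: "((1 + fps_X) ^ n :: rat fps) $ k = of_nat (n choose k)"
proof -
  have "(1 + fps_X) ^ n = (\<Sum>i\<le>n. of_nat (n choose i) * fps_X ^ i :: rat fps)"
    using binomial_ring[of "fps_X :: rat fps" 1 n] by (simp add: add.commute)
  also have "\<dots> $ k = (\<Sum>i\<le>n. if i = k then of_nat (n choose i) else 0)"
    unfolding fps_sum_nth by (intro sum.cong) (auto simp: fps_of_nat[symmetric])
  finally show ?thesis by (simp add: binomial_eq_0)
qed

lemma excess_part_root_ser: "excess_part k root_ser = (\<Sum>m=0..k. Dy_choose (Suc m) (F (k - m)))"
proof (rule fps2_eqI)
  fix r s
  have "(\<Sum>i<s. (1 + fps_X) ^ i :: rat fps) $ m = of_nat (s choose Suc m)" for m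
  proof -
    have "(\<Sum>i<s. (1 + fps_X) ^ i :: rat fps) $ m = of_nat (\<Sum>i<s. i choose m)"
      by (simp add: fps_sum_nth one_plus_X_power_nth)
    also have "(\<Sum>i<s. i choose m) = s choose Suc m"
      by (induction s) (simp_all add: add.commute)
    finally show ?thesis .
  qed
  then show "excess_part k root_ser $ r $ s = (\<Sum>m=0..k. Dy_choose (Suc m) (F (k - m))) $ r $ s"
    by (simp only: excess_part_nth root_ser_def coeffwise_nth fps_mult_nth[of "sum _ _"] fps_sum_nth excess_ser_nth_nth Dy_choose_nth)
qed

theorem F_PDE:
  "of_nat k * F (Suc k) + Dx (F (Suc k)) + Dy (F (Suc k)) + (of_nat k - 1) * F k + Dx (F k) + Dy (F k)
    = Dx (Dy (F k)) + (\<Sum>i=0..Suc k. Dx (F i) * Dy (F (Suc k - i)))"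
proof -
  have "excess_part (Suc k) (Dt excess_ser + Dx excess_ser + Dy excess_ser - excess_ser) + excess_part k (Dt excess_ser + Dx excess_ser + Dy excess_ser - excess_ser)
      = excess_part k (Dx (Dy excess_ser)) + (\<Sum>i=0..Suc k. excess_part i (Dx excess_ser) * excess_part (Suc k - i) (Dy excess_ser))"
    by (simp only: excess_part_const3_1_X[symmetric] PDE_excess_ser excess_part_add excess_part_const3_X excess_part_mult[of _ "Dx excess_ser" "Dy excess_ser"])
  then show ?thesis
    by (simp only: excess_part_add excess_part_diff excess_part_Dx excess_part_Dy excess_part_Dt excess_part_excess_ser) (simp add: algebra_simps)
qed

definition root_coeff :: "nat \<Rightarrow> fps2" where
  "root_coeff k = (\<Sum>m=0..k. Dy_choose (Suc m) (F (k - m)))"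

text \<open>The term i = k is zero, and i = 0 contains \<open>F k\<close> only through
  \<open>Dy (F k)\<close>. So \<open>F k\<close> enters linearly through its two first derivatives,
  and no integration remains.\<close>

theorem F_root_recursion:
  "of_nat k * Dx (F k) = (\<Sum>i=0..k. Dx (F i) * (of_nat (k - i) * root_coeff (k - i)))"
  using arg_cong[OF Dt_Dx_excess_ser, of "excess_part k"]
  by (simp add: excess_part_mult excess_part_Dx excess_part_Dt excess_part_excess_ser excess_part_root_ser root_coeff_def)

lemma root_coeff_0: "root_coeff 0 = Dy (F 0)"
  by (rule fps2_eqI) (simp add: root_coeff_def)

text \<open>Together with \<open>Dy_X\<close> this is the logarithmic derivative of
  \<open>T_x = x exp T_y\<close>, the lowest order in \<open>t\<close> of the root equation.\<close>

theorem Dx_X: "Dx (Dx (F 0)) = Dx (F 0) * (1 + Dx (Dy (F 0)))"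
proof -
  have "excess_part 0 1 = 1" by (rule fps2_eqI) auto
  then show ?thesis using arg_cong[OF Dx_Dx_excess_ser, of "excess_part 0"]
    by (simp add: excess_part_mult excess_part_add excess_part_Dx excess_part_excess_ser excess_part_root_ser flip: root_coeff_0) (simp add: root_coeff_def)
qed

theorem Dy_X: "Dy (Dx (F 0)) = Dx (F 0) * Dy (Dy (F 0))"
  using arg_cong[OF Dy_Dx_excess_ser, of "excess_part 0"]
  by (simp add: excess_part_mult excess_part_Dx excess_part_Dy excess_part_excess_ser excess_part_root_ser flip: root_coeff_0) (simp add: root_coeff_def)

subsection \<open>The algebra generated by \<open>T_x\<close>, \<open>T_y\<close> and \<open>1 / (1 - W)\<close>\<close>

abbreviation const2 :: "rat \<Rightarrow> fps2" where
  "const2 c \<equiv> fps_const (fps_const c)"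

lemma const2_of_nat: "const2 (of_nat n) = of_nat n"
  by (simp add: fps_of_nat)

lemma of_nat_divide_fps2: "const2 (1 / of_nat (Suc n)) * (of_nat (Suc n) * A) = A"
proof -
  have "const2 (1 / of_nat (Suc n)) * of_nat (Suc n) = 1"
    by (simp only: const2_of_nat[symmetric] fps_const_mult) simp
  then show ?thesis by (simp only: mult.assoc[symmetric] mult_1_left)
qed

definition J :: fps2 where "J = 1 / (1 - W) ^ 1"

lemma J_inverse: "J * (1 - W) = 1"
  using divide_one_minus_W_power[of 1 1] by (simp add: J_def)

lemma J_unfold: "J = 1 + J * W"
  using J_inverse by (simp add: algebra_simps)

lemma T_x_eq: "T_x = Dx (F 0)" and T_y_eq: "T_y = Dy (F 0)"
  by (simp_all add: T_x_def T_y_def D_x_eq_Dx D_y_eq_Dy T_def)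

lemma swap_T_x: "fps2_swap T_x = T_y" and swap_T_y: "fps2_swap T_y = T_x"
  by (simp_all add: T_x_eq T_y_eq swap_Dx swap_Dy swap_F)

lemma swap_W: "fps2_swap W = W"
  by (simp add: W_def fps2_swap_mult swap_T_x swap_T_y mult.commute)

lemma divide_one_minus_W: "(1 - W) * A = B \<Longrightarrow> A = J * B"
  using J_inverse by (metis mult.assoc mult_1)

lemma swap_J: "fps2_swap J = J"
proof -
  have "fps2_swap J * (1 - W) = 1"
    using arg_cong[OF J_inverse, of fps2_swap]
    by (simp add: fps2_swap_mult fps2_swap_diff fps2_swap_one swap_W)
  then have "(1 - W) * fps2_swap J = 1" by (simp add: mult.commute)
  from divide_one_minus_W[OF this] show ?thesis by simp
qed

lemma swap_const2: "fps2_swap (const2 c) = const2 c"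
  by (rule fps2_eqI) simp

text \<open>\<open>Dx_X\<close> and the mirror image of \<open>Dy_X\<close> are linear equations for
  \<open>Dx T_x\<close> and \<open>Dx T_y\<close>; their determinant \<open>1 - W\<close> is where
  the only pole comes from.\<close>

lemma Dx_T_x: "Dx T_x = T_x * J"
proof -
  have "Dx (Dy (F 0)) = Dy (F 0) * Dx (Dx (F 0))"
    using arg_cong[OF Dy_X, of fps2_swap] by (simp add: fps2_swap_mult swap_Dx swap_Dy swap_F)
  then have "Dx T_x = T_x * (1 + T_y * Dx T_x)"
    using Dx_X by (simp only: T_x_eq T_y_eq)
  then have "(1 - W) * Dx T_x = T_x" unfolding W_def by algebra
  from divide_one_minus_W[OF this] show ?thesis by (simp add: mult.commute)
qed

lemma Dx_T_y: "Dx T_y = T_y * (J * T_x)"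
proof -
  have "Dx (Dy (F 0)) = Dy (F 0) * Dx (Dx (F 0))"
    using arg_cong[OF Dy_X, of fps2_swap] by (simp add: fps2_swap_mult swap_Dx swap_Dy swap_F)
  then show ?thesis using Dx_T_x by (simp add: T_x_eq T_y_eq mult_ac)
qed

lemma Dx_const2: "Dx (const2 c) = 0"
  by (rule fps2_eqI) simp

lemma Dx_one: "Dx 1 = (0 :: fps2)"
  using Dx_const2[of 1] by simp

lemma Dx_W: "Dx W = W * (J * (1 + T_x))"
  by (simp add: W_def Dx_mult Dx_T_x Dx_T_y algebra_simps)

lemma Dx_J: "Dx J = J * (J ^ 2 * W * (1 + T_x))"
proof -
  have "Dx J * (1 - W) - J * Dx W = 0"
    using arg_cong[OF J_inverse, of Dx] by (simp add: Dx_mult Dx_diff Dx_one)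
  then have "(1 - W) * Dx J = J * (W * (J * (1 + T_x)))"
    by (simp add: Dx_W mult.commute)
  from divide_one_minus_W[OF this] show ?thesis by (simp add: power2_eq_square mult_ac)
qed

text \<open>Derivatives are kept in the form \<open>A * L\<close> so that powers, including the
  zeroth, need no exponent n - 1.\<close>

lemma Dx_power_log:
  fixes A :: fps2
  assumes "Dx A = A * L"
  shows "Dx (A ^ n) = A ^ n * (of_nat n * L)"
  by (induction n) (simp_all add: Dx_one Dx_mult assms algebra_simps)

lemma Dy_via_swap: "Dy A = fps2_swap (Dx (fps2_swap A))"
  by (simp add: swap_Dx)

definition Eul :: "fps2 \<Rightarrow> fps2" where
  "Eul A = (1 - T_y) * Dx A + (1 - T_x) * Dy A"

lemma Eul_mult: "Eul (A * B) = Eul A * B + A * Eul B"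
  by (simp add: Eul_def Dx_mult Dy_mult algebra_simps)

lemma Eul_add: "Eul (A + B) = Eul A + Eul B"
  by (simp add: Eul_def Dx_add Dy_add algebra_simps)

lemma swap_Eul: "fps2_swap (Eul A) = Eul (fps2_swap A)"
  by (simp add: Eul_def fps2_swap_add fps2_swap_mult fps2_swap_diff fps2_swap_one swap_T_x swap_T_y
    swap_Dx swap_Dy algebra_simps)

lemma Eul_const2: "Eul (const2 c) = 0"
  by (simp add: Eul_def Dx_const2 Dy_via_swap swap_const2)

lemma Dy_T_x: "Dy T_x = T_x * (J * T_y)"
  by (simp add: Dy_via_swap swap_T_x Dx_T_y fps2_swap_mult swap_T_y swap_J)

lemma Dy_J: "Dy J = J * (J ^ 2 * W * (1 + T_y))"
  by (simp add: Dy_via_swap swap_J Dx_J fps2_swap_mult fps2_swap_power swap_W fps2_swap_add fps2_swap_one swap_T_x)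

lemma Eul_T_x: "Eul T_x = T_x"
proof -
  have "Eul T_x = T_x * (J * (1 - W))"
    by (simp add: Eul_def Dx_T_x Dy_T_x W_def algebra_simps)
  then show ?thesis by (simp add: J_inverse)
qed

lemma Eul_T_y: "Eul T_y = T_y"
  using arg_cong[OF Eul_T_x, of fps2_swap] by (simp add: swap_Eul swap_T_x)

lemma Eul_J: "Eul J = J * (2 * J * W)"
proof -
  have "Eul J = J * (2 * J * W) * (J * (1 - W))"
    by (simp add: Eul_def Dx_J Dy_J power2_eq_square) (simp add: W_def algebra_simps)
  then show ?thesis by (simp add: J_inverse)
qed

lemma Eul_power_log:
  assumes "Eul A = A * L"
  shows "Eul (A ^ n) = A ^ n * (of_nat n * L)"
proof (induction n)
  case 0
  then show ?case using Eul_const2[of 1] by simp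
qed (simp add: Eul_mult assms algebra_simps)

section \<open>Spans of monomials in \<open>T_x\<close>, \<open>T_y\<close> and the order of their
  poles\<close>

inductive_set mspan :: "(nat \<times> nat) set \<Rightarrow> fps2 set" for M where
  zero: "0 \<in> mspan M"
| step: "A \<in> mspan M \<Longrightarrow> (a, b) \<in> M \<Longrightarrow> A + const2 c * (T_x ^ a * T_y ^ b) \<in> mspan M"

lemma mspan_monomial: "(a, b) \<in> M \<Longrightarrow> const2 c * (T_x ^ a * T_y ^ b) \<in> mspan M"
  using mspan.step[OF mspan.zero] by simp

lemma mspan_add:
  assumes "A \<in> mspan M" "B \<in> mspan M"
  shows "A + B \<in> mspan M"
  using assms(2) by induction (auto simp: assms(1) add.assoc[symmetric] intro: mspan.step)

lemma mspan_sum: "(\<And>i. i \<in> I \<Longrightarrow> f i \<in> mspan M) \<Longrightarrow> sum f I \<in> mspan M"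
  by (induction I rule: infinite_finite_induct) (auto intro: mspan.zero mspan_add)

lemma mspan_mult:
  assumes A: "A \<in> mspan M" and B: "B \<in> mspan N"
    and MN: "\<And>a b a' b'. (a, b) \<in> M \<Longrightarrow> (a', b') \<in> N \<Longrightarrow> (a + a', b + b') \<in> K"
  shows "A * B \<in> mspan K"
  using A
proof induction
  case zero
  then show ?case by (simp add: mspan.zero)
next
  case (step A a b c)
  have "const2 c * (T_x ^ a * T_y ^ b) * B \<in> mspan K"
    using B
  proof induction
    case zero
    then show ?case by (simp add: mspan.zero)
  next
    case (step B a' b' c')
    have "const2 c * (T_x ^ a * T_y ^ b) * (const2 c' * (T_x ^ a' * T_y ^ b'))
        = const2 c * const2 c' * (T_x ^ (a + a') * T_y ^ (b + b'))"
      by (simp only: power_add mult_ac)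
    also have "\<dots> \<in> mspan K"
      unfolding fps_const_mult using MN \<open>(a, b) \<in> M\<close> \<open>(a', b') \<in> N\<close> by (intro mspan_monomial)
    finally show ?case using step.IH by (simp only: distrib_left mspan_add)
  qed
  with step.IH show ?case by (simp only: distrib_right mspan_add)
qed

lemma mspan_mono: "A \<in> mspan M \<Longrightarrow> M \<subseteq> N \<Longrightarrow> A \<in> mspan N"
  by (induction rule: mspan.induct) (auto intro: mspan.intros)

lemma mspan_const2: "const2 c \<in> mspan UNIV"
  using mspan_monomial[of 0 0 UNIV c] by simp

lemma mspan_scale: "A \<in> mspan M \<Longrightarrow> const2 c * A \<in> mspan M"
  using mspan_mult[of "const2 c" "{(0, 0)}" A M M] mspan_monomial[of 0 0 "{(0, 0)}" c] by simp

lemma mspan_of_nat: "A \<in> mspan M \<Longrightarrow> of_nat n * A \<in> mspan M"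
  using mspan_scale[of A M "of_nat n"] by (simp only: const2_of_nat)

lemma mspan_uminus: "A \<in> mspan M \<Longrightarrow> - A \<in> mspan M"
  using mspan_scale[of A M "-1"] by (simp flip: fps_const_neg)

lemma mspan_diff: "A \<in> mspan M \<Longrightarrow> B \<in> mspan M \<Longrightarrow> A - B \<in> mspan M"
  using mspan_add[OF _ mspan_uminus] by fastforce

text \<open>Stability under multiplication by \<open>W\<close> and under exchange of
  \<open>x\<close> and \<open>y\<close>: the first allows a fraction to be expanded by
  \<open>1 - W\<close>, the second allows \<open>Dy\<close> to be reduced to
  \<open>Dx\<close>.\<close>

definition diag_closed :: "(nat \<times> nat) set \<Rightarrow> bool" where
  "diag_closed M \<longleftrightarrow> (\<forall>(a, b)\<in>M. (Suc a, Suc b) \<in> M \<and> (b, a) \<in> M)"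

lemma mspan_W:
  assumes "A \<in> mspan M" "diag_closed M"
  shows "W * A \<in> mspan M"
  using mspan_mult[of W "{(1, 1)}" A M M] mspan_monomial[of 1 1 "{(1, 1)}" 1] assms
  by (force simp: W_def diag_closed_def)

lemma mspan_one_minus_W_power:
  assumes "A \<in> mspan M" "diag_closed M"
  shows "(1 - W) ^ n * A \<in> mspan M"
proof (induction n)
  case (Suc n)
  have "(1 - W) ^ Suc n * A = (1 - W) ^ n * A - W * ((1 - W) ^ n * A)" by (simp add: algebra_simps)
  then show ?case using mspan_diff[OF Suc mspan_W[OF Suc assms(2)]] by simp
qed (simp add: assms)

lemma mspan_swap:
  assumes "A \<in> mspan M" "diag_closed M"
  shows "fps2_swap A \<in> mspan M"
  using assms(1)
proof induction
  case zero
  then show ?case by (simp add: mspan.zero)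
next
  case (step A a b c)
  have "fps2_swap (A + const2 c * (T_x ^ a * T_y ^ b)) = fps2_swap A + const2 c * (T_x ^ b * T_y ^ a)"
    by (simp add: fps2_swap_add fps2_swap_mult fps2_swap_power swap_T_x swap_T_y swap_const2 mult.commute)
  moreover have "(b, a) \<in> M" using step(2) assms(2) by (auto simp: diag_closed_def)
  ultimately show ?case using step.IH mspan.step by auto
qed

definition rspan :: "(nat \<times> nat) set \<Rightarrow> nat \<Rightarrow> fps2 set" where
  "rspan M n = {J ^ n * A | A. A \<in> mspan M}"

lemma rspanI: "A \<in> mspan M \<Longrightarrow> J ^ n * A \<in> rspan M n"
  by (auto simp: rspan_def)

lemma rspan_add:
  assumes "A \<in> rspan M n" "B \<in> rspan M n"
  shows "A + B \<in> rspan M n"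
proof -
  obtain A' B' where "A = J ^ n * A'" "B = J ^ n * B'" "A' \<in> mspan M" "B' \<in> mspan M"
    using assms by (auto simp: rspan_def)
  then show ?thesis using rspanI[OF mspan_add[of A' M B'], of n] by (simp add: distrib_left)
qed

lemma rspan_scale: "A \<in> rspan M n \<Longrightarrow> const2 c * A \<in> rspan M n"
  using rspanI[OF mspan_scale] by (force simp: rspan_def mult.left_commute)

lemma rspan_of_nat: "A \<in> rspan M n \<Longrightarrow> of_nat k * A \<in> rspan M n"
  using rspan_scale[of A M n "of_nat k"] by (simp only: const2_of_nat)

lemma rspan_uminus: "A \<in> rspan M n \<Longrightarrow> - A \<in> rspan M n"
  using rspan_scale[of A M n "-1"] by (simp flip: fps_const_neg)

lemma rspan_diff: "A \<in> rspan M n \<Longrightarrow> B \<in> rspan M n \<Longrightarrow> A - B \<in> rspan M n"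
  using rspan_add[OF _ rspan_uminus] by fastforce

lemma rspan_zero: "0 \<in> rspan M n"
  using rspanI[OF mspan.zero] by simp

lemma rspan_sum: "(\<And>i. i \<in> I \<Longrightarrow> f i \<in> rspan M n) \<Longrightarrow> sum f I \<in> rspan M n"
  by (induction I rule: infinite_finite_induct) (auto intro: rspan_zero rspan_add)

lemma rspan_mult:
  assumes "A \<in> rspan M n" "B \<in> rspan N m"
    and "\<And>a b a' b'. (a, b) \<in> M \<Longrightarrow> (a', b') \<in> N \<Longrightarrow> (a + a', b + b') \<in> K"
  shows "A * B \<in> rspan K (n + m)"
proof -
  obtain A' B' where "A = J ^ n * A'" "B = J ^ m * B'" "A' \<in> mspan M" "B' \<in> mspan N"
    using assms by (auto simp: rspan_def)
  then show ?thesis using rspanI[OF mspan_mult[of A' M B' N K], of "n + m"] assms(3)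
    by (simp add: power_add mult_ac)
qed

lemma J_power_inverse: "J ^ n * (1 - W) ^ n = 1"
  using J_inverse by (simp add: power_mult_distrib[symmetric])

lemma rspan_mono:
  assumes "A \<in> rspan M n" "diag_closed M" "n \<le> m" "M \<subseteq> N"
  shows "A \<in> rspan N m"
proof -
  obtain A' where A': "A = J ^ n * A'" "A' \<in> mspan M" using assms by (auto simp: rspan_def)
  have "A = J ^ n * (J ^ (m - n) * (1 - W) ^ (m - n)) * A'"
    by (simp add: A' J_power_inverse)
  also have "\<dots> = J ^ m * ((1 - W) ^ (m - n) * A')"
    using assms(3) by (simp add: mult_ac flip: power_add)
  also have "\<dots> \<in> rspan N m"
    by (rule rspanI, rule mspan_mono[OF mspan_one_minus_W_power[OF A'(2) assms(2)] assms(4)])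
  finally show ?thesis .
qed

lemma rspan_W: "A \<in> rspan M n \<Longrightarrow> diag_closed M \<Longrightarrow> W * A \<in> rspan M n"
  using rspanI[OF mspan_W] by (force simp: rspan_def mult.left_commute)

lemma rspan_J: "A \<in> rspan M n \<Longrightarrow> J * A \<in> rspan M (Suc n)"
  by (force simp: rspan_def mult.assoc)

lemma rspan_swap: "A \<in> rspan M n \<Longrightarrow> diag_closed M \<Longrightarrow> fps2_swap A \<in> rspan M n"
  using mspan_swap by (force simp: rspan_def fps2_swap_mult fps2_swap_power swap_J)

text \<open>The increase by two comes from \<open>Dx J = J ^ 3 * W * (1 + T_x)\<close>; monomials
  contribute a single \<open>J\<close>. The factor \<open>T_x\<close> stays explicit because it is
  the only source of exponents outside \<open>M\<close>.\<close>

lemma Dx_rspan: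
  assumes A: "A \<in> rspan M n" and M: "diag_closed M"
  obtains B C where "B \<in> rspan M (n + 2)" "C \<in> rspan M (n + 2)" "Dx A = B + T_x * C"
proof -
  obtain A' where A': "A = J ^ n * A'" "A' \<in> mspan M" using A by (auto simp: rspan_def)
  from A'(2) have "\<exists>B C. B \<in> rspan M (n + 2) \<and> C \<in> rspan M (n + 2) \<and> Dx (J ^ n * A') = B + T_x * C"
  proof induction
    case zero
    have "Dx (J ^ n * 0) = 0 + T_x * 0" by (rule fps2_eqI) simp
    then show ?case using rspan_zero by blast
  next
    case (step A a b c)
    define m where "m = const2 c * (T_x ^ a * T_y ^ b)"
    have m: "m \<in> mspan M" unfolding m_def using step(2) by (rule mspan_monomial)
    have Dm: "Dx m = m * (of_nat a * J + of_nat b * (J * T_x))"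
      by (simp add: m_def Dx_mult Dx_const2 Dx_power_log[OF Dx_T_x] Dx_power_log[OF Dx_T_y] algebra_simps)
    \<comment> \<open>Brings the simple poles of the monomial derivatives to the common power
      \<open>J ^ (n + 2)\<close>.\<close>
    have J: "J = J ^ 2 * (1 - W)"
      using J_inverse by (simp add: power2_eq_square mult.assoc)
    have part: "J ^ (n + 2) * (of_nat n * (W * m) + of_nat p * ((1 - W) ^ 1 * m)) \<in> rspan M (n + 2)" for p
      by (intro rspanI mspan_add mspan_of_nat mspan_W mspan_one_minus_W_power m M)
    have "Dx (J ^ n * m) = J ^ n * m * (of_nat n * (J ^ 2 * W * (1 + T_x)) + of_nat a * J + of_nat b * (J * T_x))"
      by (simp add: Dx_mult Dm Dx_power_log[OF Dx_J] algebra_simps)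
    also have "\<dots> = J ^ n * m * (of_nat n * (J ^ 2 * W * (1 + T_x)) + of_nat a * (J ^ 2 * (1 - W)) + of_nat b * (J ^ 2 * (1 - W) * T_x))"
      using J by simp
    also have "\<dots> = J ^ (n + 2) * (of_nat n * (W * m) + of_nat a * ((1 - W) ^ 1 * m))
        + T_x * (J ^ (n + 2) * (of_nat n * (W * m) + of_nat b * ((1 - W) ^ 1 * m)))"
      unfolding power_add by (simp add: algebra_simps)
    finally have Dm': "Dx (J ^ n * m) = \<dots>" .
    from step.IH obtain B C where BC: "B \<in> rspan M (n + 2)" "C \<in> rspan M (n + 2)" "Dx (J ^ n * A) = B + T_x * C"
      by blast
    have "Dx (J ^ n * (A + m)) = Dx (J ^ n * A) + Dx (J ^ n * m)"
      by (simp add: distrib_left Dx_add)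
    also have "\<dots> = (B + J ^ (n + 2) * (of_nat n * (W * m) + of_nat a * ((1 - W) ^ 1 * m)))
        + T_x * (C + J ^ (n + 2) * (of_nat n * (W * m) + of_nat b * ((1 - W) ^ 1 * m)))"
      unfolding Dm' BC(3) by (simp only: distrib_left add_ac)
    finally show ?case
      unfolding m_def[symmetric] using rspan_add[OF BC(1) part[of a]] rspan_add[OF BC(2) part[of b]] by blast
  qed
  then show ?thesis using that A'(1) by blast
qed

subsection \<open>Rationality and derivatives\<close>

lemma diag_closed_UNIV: "diag_closed UNIV"
  by (simp add: diag_closed_def)

definition ratl :: "fps2 set" where
  "ratl = (\<Union>n. rspan UNIV n)"

lemma ratl_lift:
  assumes "A \<in> ratl" "B \<in> ratl"
  obtains n where "A \<in> rspan UNIV n" "B \<in> rspan UNIV n"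
proof -
  obtain n m where "A \<in> rspan UNIV n" "B \<in> rspan UNIV m" using assms by (auto simp: ratl_def)
  then show ?thesis
    using that[of "max n m"] rspan_mono[OF _ diag_closed_UNIV, of _ _ "max n m" UNIV] by simp
qed

lemma ratlI: "A \<in> rspan UNIV n \<Longrightarrow> A \<in> ratl"
  by (auto simp: ratl_def)

lemma ratl_add: "A \<in> ratl \<Longrightarrow> B \<in> ratl \<Longrightarrow> A + B \<in> ratl"
  by (metis ratl_lift ratlI rspan_add)

lemma ratl_diff: "A \<in> ratl \<Longrightarrow> B \<in> ratl \<Longrightarrow> A - B \<in> ratl"
  by (metis ratl_lift ratlI rspan_diff)

lemma ratl_mult: "A \<in> ratl \<Longrightarrow> B \<in> ratl \<Longrightarrow> A * B \<in> ratl"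
  by (metis ratl_lift ratlI rspan_mult UNIV_I)

lemma mspan_ratl: "A \<in> mspan UNIV \<Longrightarrow> A \<in> ratl"
  using rspanI[of A UNIV 0] by (auto simp: ratl_def)

lemma ratl_const2: "const2 c \<in> ratl"
  by (rule mspan_ratl[OF mspan_const2])

lemma ratl_of_nat: "of_nat n \<in> ratl"
  using ratl_const2[of "of_nat n"] by (simp only: const2_of_nat)

lemma ratl_one: "1 \<in> ratl"
  using ratl_of_nat[of 1] by simp

lemma ratl_T_x: "T_x \<in> ratl" and ratl_T_y: "T_y \<in> ratl"
  using mspan_monomial[of 1 0 UNIV 1] mspan_monomial[of 0 1 UNIV 1] by (auto intro: mspan_ratl)

lemma ratl_J: "J \<in> ratl"
  using rspan_J[of 1 UNIV 0] rspanI[of 1 UNIV 0] mspan_const2[of 1] by (auto intro: ratlI)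

lemma ratl_sum: "(\<And>i. i \<in> I \<Longrightarrow> f i \<in> ratl) \<Longrightarrow> sum f I \<in> ratl"
  using ratl_const2[of 0] by (induction I rule: infinite_finite_induct) (auto intro: ratl_add)

lemma ratl_Dx: "A \<in> ratl \<Longrightarrow> Dx A \<in> ratl"
proof -
  assume "A \<in> ratl"
  then obtain n where "A \<in> rspan UNIV n" by (auto simp: ratl_def)
  then obtain B C where "B \<in> rspan UNIV (n + 2)" "C \<in> rspan UNIV (n + 2)" "Dx A = B + T_x * C"
    by (rule Dx_rspan[OF _ diag_closed_UNIV])
  then show ?thesis by (metis ratl_add ratl_mult ratl_T_x ratlI)
qed

lemma ratl_swap: "A \<in> ratl \<Longrightarrow> fps2_swap A \<in> ratl"
  using rspan_swap[OF _ diag_closed_UNIV] by (auto simp: ratl_def)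

lemma ratl_Dy: "A \<in> ratl \<Longrightarrow> Dy A \<in> ratl"
  by (simp add: Dy_via_swap ratl_swap ratl_Dx)

lemma ratl_of_nat_cancel: "of_nat (Suc n) * A \<in> ratl \<Longrightarrow> A \<in> ratl"
  using ratl_mult[OF ratl_const2, of "of_nat (Suc n) * A" "1 / of_nat (Suc n)"]
  by (simp only: of_nat_divide_fps2)

lemma swap_Dx_F: "fps2_swap (Dx (F k)) = Dy (F k)"
  and swap_Dy_F: "fps2_swap (Dy (F k)) = Dx (F k)"
  by (simp_all add: swap_Dx swap_Dy swap_F)

lemma Dy_choose_one: "Dy_choose (Suc 0) A = Dy A"
  by (rule fps2_eqI) simp

text \<open>Every binomial in \<open>D_y\<close> of positive index contains a factor
  \<open>D_y\<close>. Hence rationality of \<open>Dy A\<close> is enough, as is needed for A =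
  \<open>F 1\<close>.\<close>

lemma ratl_Dy_choose: "Dy A \<in> ratl \<Longrightarrow> Dy_choose (Suc m) A \<in> ratl"
proof (induction m)
  case 0
  then show ?case by (simp add: Dy_choose_one)
next
  case (Suc m)
  have "of_nat (Suc (Suc m)) * Dy_choose (Suc (Suc m)) A \<in> ratl"
    unfolding Dy_choose_Suc[of "Suc m"] using Suc
    by (intro ratl_diff ratl_mult ratl_Dy ratl_of_nat) auto
  then show ?case by (rule ratl_of_nat_cancel)
qed

lemma root_coeff_split: "root_coeff k = Dy (F k) + (\<Sum>m=1..k. Dy_choose (Suc m) (F (k - m)))"
  unfolding root_coeff_def by (subst sum.atLeast_Suc_atMost) (simp_all add: Dy_choose_one)

text \<open>The terms of the root recursion containing \<open>F k\<close> and their mirror images form a linear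
  system of determinant \<open>1 - W\<close> for the two derivatives of \<open>F k\<close>.\<close>

lemma solve_swap_system:
  assumes "A = T_x * fps2_swap A + B"
  shows "A = J * (B + T_x * fps2_swap B)"
proof (rule divide_one_minus_W)
  have "fps2_swap A = T_y * A + fps2_swap B"
    using arg_cong[OF assms, of fps2_swap] by (simp add: fps2_swap_add fps2_swap_mult swap_T_x)
  then have "A = T_x * (T_y * A + fps2_swap B) + B" using assms by simp
  then show "(1 - W) * A = B + T_x * fps2_swap B" unfolding W_def by algebra
qed

lemma Dx_F_ratl: "Dx (F k) \<in> ratl"
proof (induction k rule: less_induct)
  case (less k)
  show ?case
  proof (cases k)
    case 0
    then show ?thesis using ratl_T_x by (simp add: T_x_eq)
  next
    case (Suc n)
    have DyF: "Dy (F j) \<in> ratl" if "j < k" for j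
      using ratl_swap[OF less[OF that]] by (simp add: swap_Dx_F)
    have U: "root_coeff j \<in> ratl" if "j < k" for j
      unfolding root_coeff_def using DyF that by (intro ratl_sum ratl_Dy_choose) auto
    define R where "R = (\<Sum>m=1..k. Dy_choose (Suc m) (F (k - m)))"
    have R: "R \<in> ratl" unfolding R_def using DyF by (intro ratl_sum ratl_Dy_choose) auto
    define V where "V = (\<Sum>i=1..n. Dx (F i) * (of_nat (k - i) * root_coeff (k - i)))"
    have V: "V \<in> ratl" unfolding V_def using less U Suc
      by (intro ratl_sum ratl_mult ratl_of_nat) auto
    \<comment> \<open>The term i = 0 supplies \<open>T_x * root_coeff k\<close>; the term i = k
      vanishes, so \<open>V\<close> stops at n = k - 1.\<close>
    have "of_nat k * Dx (F k) = T_x * (of_nat k * root_coeff k) + V"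
      unfolding F_root_recursion[of k] V_def
      by (simp add: Suc T_x_eq sum.atLeast_Suc_atMost[of 0])
    then have "of_nat (Suc n) * Dx (F k) = of_nat (Suc n) * (T_x * root_coeff k + const2 (1 / of_nat (Suc n)) * V)"
      using of_nat_divide_fps2[of n V]
      by (simp add: Suc algebra_simps del: of_nat_Suc fps_const_mult_left)
    then have "Dx (F k) = T_x * root_coeff k + const2 (1 / of_nat (Suc n)) * V"
      by (metis of_nat_divide_fps2)
    also have "\<dots> = T_x * fps2_swap (Dx (F k)) + (T_x * R + const2 (1 / of_nat (Suc n)) * V)"
      by (simp only: root_coeff_split R_def[symmetric] swap_Dx_F distrib_left add_ac)
    finally have "Dx (F k) = J * ((T_x * R + const2 (1 / of_nat (Suc n)) * V)
        + T_x * fps2_swap (T_x * R + const2 (1 / of_nat (Suc n)) * V))"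
      by (rule solve_swap_system)
    also have "\<dots> \<in> ratl"
      by (intro ratl_mult ratl_add ratl_swap ratl_J ratl_T_x ratl_const2 R V)
    finally show ?thesis .
  qed
qed

lemma Dy_F_ratl: "Dy (F k) \<in> ratl"
  using ratl_swap[OF Dx_F_ratl[of k]] by (simp add: swap_Dx_F)

definition edge_rhs :: "nat \<Rightarrow> fps2" where
  "edge_rhs k = Dx (Dy (F k)) - Dx (F k) - Dy (F k) - of_nat (k - 1) * F k
    + (\<Sum>i=1..k. Dx (F i) * Dy (F (Suc k - i)))"

lemma Eul_F:
  assumes "k \<ge> 1"
  shows "of_nat k * F (Suc k) + Eul (F (Suc k)) = edge_rhs k"
proof -
  have "(\<Sum>i=0..Suc k. Dx (F i) * Dy (F (Suc k - i)))
      = T_x * Dy (F (Suc k)) + (\<Sum>i=1..k. Dx (F i) * Dy (F (Suc k - i))) + Dx (F (Suc k)) * T_y"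
    by (simp add: T_x_eq T_y_eq sum.atLeast_Suc_atMost[of 0])
  moreover have k1: "of_nat (k - 1) = (of_nat k - 1 :: fps2)" using assms by (simp add: of_nat_diff)
  ultimately show ?thesis using F_PDE[of k]
    unfolding edge_rhs_def Eul_def k1 by (simp add: algebra_simps)
qed

text \<open>The derivatives are already rational, so \<open>Eul (F (k + 1))\<close> is too, and the
  equation is solved for \<open>F (k + 1)\<close> by dividing by \<open>k\<close>. At k = 1 the
  coefficient \<open>k - 1\<close> removes the logarithmic \<open>F 1\<close>.\<close>

lemma F_ratl: "k \<ge> 2 \<Longrightarrow> F k \<in> ratl"
proof (induction k)
  case (Suc k)
  then obtain n where k: "k = Suc n" by (cases k) auto
  have "of_nat (k - 1) * F k \<in> ratl"
    using Suc.IH by (cases "k = 1") (use k ratl_const2[of 0] in \<open>auto intro: ratl_mult ratl_of_nat\<close>)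
  then have "edge_rhs k \<in> ratl"
    unfolding edge_rhs_def
    by (intro ratl_add ratl_diff ratl_sum ratl_mult[OF Dx_F_ratl] ratl_Dx[OF Dy_F_ratl] Dx_F_ratl Dy_F_ratl)
  moreover have "Eul (F (Suc k)) \<in> ratl"
    unfolding Eul_def by (intro ratl_add ratl_mult ratl_diff ratl_one ratl_T_x ratl_T_y Dx_F_ratl Dy_F_ratl)
  ultimately have "edge_rhs k - Eul (F (Suc k)) \<in> ratl" by (rule ratl_diff)
  moreover have "edge_rhs k - Eul (F (Suc k)) = of_nat (Suc n) * F (Suc k)"
    using Eul_F[of k] k by (simp add: algebra_simps)
  ultimately show ?case using ratl_of_nat_cancel by simp
qed simp

text \<open>The bound 2 on both exponents yields the factor \<open>W ^ 2\<close>, and the bound on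
  their difference becomes the degree in \<open>Z\<close>.\<close>

definition band :: "nat \<Rightarrow> (nat \<times> nat) set" where
  "band d = {(a, b). 2 \<le> a \<and> 2 \<le> b \<and> a \<le> b + d \<and> b \<le> a + d}"

lemma diag_closed_band: "diag_closed (band d)"
  by (auto simp: diag_closed_def band_def)

lemma band_mono: "d \<le> e \<Longrightarrow> band d \<subseteq> band e"
  by (auto simp: band_def)

lemmas rspan_band_mono = rspan_mono[OF _ diag_closed_band _ band_mono]

lemma T_x_mspan: "T_x \<in> mspan {(1, 0)}" and T_y_mspan: "T_y \<in> mspan {(0, 1)}"
  using mspan_monomial[of 1 0 "{(1, 0)}" 1] mspan_monomial[of 0 1 "{(0, 1)}" 1] by simp_all

lemma rspan_band_T_x: "A \<in> rspan (band d) n \<Longrightarrow> T_x * A \<in> rspan (band (Suc d)) n"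
  and rspan_band_T_y: "A \<in> rspan (band d) n \<Longrightarrow> T_y * A \<in> rspan (band (Suc d)) n"
  using rspan_mult[OF rspanI[OF T_x_mspan, of 0], of A "band d" n "band (Suc d)"]
    rspan_mult[OF rspanI[OF T_y_mspan, of 0], of A "band d" n "band (Suc d)"]
  by (auto simp: band_def)

lemma rspan_band_mult: "A \<in> rspan (band d) n \<Longrightarrow> B \<in> rspan (band e) m \<Longrightarrow> A * B \<in> rspan (band (d + e)) (n + m)"
  by (erule rspan_mult) (auto simp: band_def)

text \<open>A derivative in \<open>x\<close> widens the band by one, but only towards powers of \<open>T_x\<close>; recording this
  avoids losing two steps in mixed second derivatives and in products \<open>Dx A * Dy B\<close>.\<close>

definition xband :: "nat \<Rightarrow> nat \<Rightarrow> fps2 set" where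
  "xband d n = {B + T_x * C | B C. B \<in> rspan (band d) n \<and> C \<in> rspan (band d) n}"

lemma Dx_xband: "A \<in> rspan (band d) n \<Longrightarrow> Dx A \<in> xband d (n + 2)"
  by (erule Dx_rspan[OF _ diag_closed_band]) (auto simp: xband_def)

lemma xband_rspan: "A \<in> xband d n \<Longrightarrow> A \<in> rspan (band (Suc d)) n"
  by (auto simp: xband_def intro!: rspan_add rspan_band_T_x intro: rspan_band_mono)

text \<open>One factor widens towards \<open>T_x\<close> and the other towards \<open>T_y\<close>.
  Where both widen, the product \<open>T_x * T_y = W\<close> preserves the band, so the total gain
  is one.\<close>

lemma xband_swap_mult:
  assumes "A \<in> xband d n" "fps2_swap B \<in> xband e m"
  shows "A * B \<in> rspan (band (Suc (d + e))) (n + m)"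
proof -
  obtain A1 A2 where A: "A = A1 + T_x * A2" "A1 \<in> rspan (band d) n" "A2 \<in> rspan (band d) n"
    using assms by (auto simp: xband_def)
  obtain B1 B2 where B: "fps2_swap B = B1 + T_x * B2" "B1 \<in> rspan (band e) m" "B2 \<in> rspan (band e) m"
    using assms by (auto simp: xband_def)
  define C1 where "C1 = fps2_swap B1"
  define C2 where "C2 = fps2_swap B2"
  have C: "C1 \<in> rspan (band e) m" "C2 \<in> rspan (band e) m"
    unfolding C1_def C2_def by (intro rspan_swap B diag_closed_band)+
  have "B = C1 + T_y * C2"
    using arg_cong[OF B(1), of fps2_swap] by (simp add: fps2_swap_add fps2_swap_mult swap_T_x C1_def C2_def)
  then have "A * B = A1 * C1 + T_x * (A2 * C1) + T_y * (A1 * C2) + W * (A2 * C2)"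
    by (simp add: A W_def algebra_simps)
  also have "\<dots> \<in> rspan (band (Suc (d + e))) (n + m)"
    using A C by (intro rspan_add rspan_band_T_x rspan_band_T_y rspan_W diag_closed_band rspan_band_mult)
      (auto intro!: rspan_band_mono[OF rspan_band_mult])
  finally show ?thesis .
qed

lemma Dy_xband:
  assumes "A \<in> xband d n"
  shows "Dy A \<in> rspan (band (Suc d)) (n + 2)"
proof -
  obtain B C where A: "A = B + T_x * C" "B \<in> rspan (band d) n" "C \<in> rspan (band d) n"
    using assms by (auto simp: xband_def)
  have Dy_form: "\<exists>P Q. P \<in> rspan (band d) (n + 2) \<and> Q \<in> rspan (band d) (n + 2) \<and> Dy E = P + T_y * Q"
    if E: "E \<in> rspan (band d) n" for E
  proof -
    obtain P Q where PQ: "P \<in> rspan (band d) (n + 2)" "Q \<in> rspan (band d) (n + 2)"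
      "Dx (fps2_swap E) = P + T_x * Q"
      by (rule Dx_rspan[OF rspan_swap[OF E diag_closed_band] diag_closed_band])
    then have "Dy E = fps2_swap P + T_y * fps2_swap Q"
      by (simp add: Dy_via_swap fps2_swap_add fps2_swap_mult swap_T_x)
    then show ?thesis using PQ rspan_swap[OF _ diag_closed_band] by blast
  qed
  obtain P Q where PQ: "P \<in> rspan (band d) (n + 2)" "Q \<in> rspan (band d) (n + 2)" "Dy B = P + T_y * Q"
    using Dy_form[OF A(2)] by blast
  obtain P' Q' where PQ': "P' \<in> rspan (band d) (n + 2)" "Q' \<in> rspan (band d) (n + 2)" "Dy C = P' + T_y * Q'"
    using Dy_form[OF A(3)] by blast
  have "Dy A = P + T_y * Q + J * (W * C) + T_x * P' + W * Q'"
    by (simp add: A(1) Dy_add Dy_mult Dy_T_x PQ(3) PQ'(3)) (simp add: W_def algebra_simps)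
  also have "\<dots> \<in> rspan (band (Suc d)) (n + 2)"
  proof (intro rspan_add rspan_band_T_x rspan_band_T_y PQ PQ')
    show "P \<in> rspan (band (Suc d)) (n + 2)" using PQ by (rule_tac rspan_band_mono) auto
    show "W * Q' \<in> rspan (band (Suc d)) (n + 2)"
      using rspan_W[OF PQ'(2) diag_closed_band] by (rule rspan_band_mono) auto
    show "J * (W * C) \<in> rspan (band (Suc d)) (n + 2)"
      using rspan_J[OF rspan_W[OF A(3) diag_closed_band]] by (rule rspan_band_mono) auto
  qed
  finally show ?thesis .
qed

text \<open>Base case, solved explicitly from the root recursion:
  \<open>Dx (F 1) = J ^ 2 * W ^ 2 * (1 + T_x) / 2\<close>.\<close>

lemma Dx_F_1: "Dx (F 1) \<in> xband 0 2"
proof -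
  have U: "root_coeff 1 = Dy (F 1) + Dy_choose 2 (F 0)"
    by (simp add: root_coeff_split numeral_2_eq_2)
  have "of_nat 2 * Dy_choose 2 (F 0) = Dy T_y - T_y"
    using Dy_choose_Suc[of "Suc 0" "F 0"] by (simp add: Dy_choose_one T_y_eq numeral_2_eq_2)
  also have "\<dots> = J * T_y * W"
  proof -
    have "Dy T_y = T_y * J" by (simp add: Dy_via_swap swap_T_y Dx_T_x fps2_swap_mult swap_T_x swap_J)
    moreover have "T_y * J = T_y * (1 + J * W)" by (simp only: J_unfold[symmetric])
    ultimately show ?thesis by (simp only: distrib_left) (simp add: mult_ac)
  qed
  finally have half: "Dy_choose 2 (F 0) = const2 (1 / 2) * (J * T_y * W)"
    using of_nat_divide_fps2[of 1 "Dy_choose 2 (F 0)"] by (simp add: numeral_2_eq_2)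
  have "Dx (F 1) = T_x * root_coeff 1"
    using F_root_recursion[of 1] by (simp add: T_x_eq)
  also have "\<dots> = T_x * fps2_swap (Dx (F 1)) + T_x * (const2 (1 / 2) * (J * T_y * W))"
    by (simp only: U half swap_Dx_F distrib_left)
  also have "T_x * (const2 (1 / 2) * (J * T_y * W)) = const2 (1 / 2) * (J * W ^ 2)"
    by (simp add: W_def power2_eq_square mult_ac)
  finally have "Dx (F 1) = T_x * fps2_swap (Dx (F 1)) + const2 (1 / 2) * (J * W ^ 2)" .
  from solve_swap_system[OF this]
  have "Dx (F 1) = J ^ 2 * (const2 (1 / 2) * (T_x ^ 2 * T_y ^ 2)) + T_x * (J ^ 2 * (const2 (1 / 2) * (T_x ^ 2 * T_y ^ 2)))"
    by (simp add: fps2_swap_mult fps2_swap_power swap_W swap_J swap_const2)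
      (simp add: W_def power2_eq_square algebra_simps)
  moreover have "J ^ 2 * (const2 (1 / 2) * (T_x ^ 2 * T_y ^ 2)) \<in> rspan (band 0) 2"
    by (intro rspanI mspan_monomial) (simp add: band_def)
  ultimately show ?thesis by (auto simp: xband_def)
qed

subsection \<open>Poles and supports\<close>

lemma mspan_Eul: "A \<in> mspan M \<Longrightarrow> Eul A \<in> mspan M"
proof (induction rule: mspan.induct)
  case zero
  then show ?case using Eul_const2[of 0] by (simp add: mspan.zero)
next
  case (step A a b c)
  have "Eul (const2 c * (T_x ^ a * T_y ^ b)) = of_nat (a + b) * (const2 c * (T_x ^ a * T_y ^ b))"
    using Eul_power_log[of T_x 1 a] Eul_power_log[of T_y 1 b]
    by (simp add: Eul_mult Eul_const2 Eul_T_x Eul_T_y algebra_simps)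
  then show ?case
    using step by (simp only: Eul_add) (intro mspan_add mspan_of_nat mspan_monomial)
qed

lemma Eul_clear_denominators:
  assumes "of_nat k * (J ^ n * P) + Eul (J ^ n * P) = J ^ Suc m * H" "m \<le> n"
  shows "(1 - W) * (of_nat k * P + Eul P) + of_nat (2 * n) * (W * P) = (1 - W) ^ (n - m) * H"
proof -
  define I where "I = 1 - W"
  have IJ: "I * J = 1" using J_inverse by (simp add: I_def mult.commute)
  have Jn: "I ^ i * J ^ i = 1" for i
    by (simp add: power_mult_distrib[symmetric] IJ)
  have "I ^ Suc n * (J ^ Suc m * H) = I ^ (n - m) * (I ^ Suc m * J ^ Suc m) * H"
    using assms(2) by (simp add: mult_ac flip: power_add power_Suc)
  also have "\<dots> = I ^ (n - m) * H" by (simp only: Jn mult_1_right)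
  finally have "I ^ (n - m) * H = I ^ Suc n * (of_nat k * (J ^ n * P) + Eul (J ^ n * P))"
    by (simp only: assms(1))
  also have "Eul (J ^ n * P) = J ^ n * Eul P + J ^ n * (of_nat n * (2 * J * W)) * P"
    by (simp add: Eul_mult Eul_power_log[OF Eul_J] algebra_simps)
  also have "I ^ Suc n * (of_nat k * (J ^ n * P) + (J ^ n * Eul P + J ^ n * (of_nat n * (2 * J * W)) * P))
      = (I ^ n * J ^ n) * (I * (of_nat k * P + Eul P) + (I * J) * (of_nat (2 * n) * (W * P)))"
    by (simp add: algebra_simps)
  finally show ?thesis by (simp only: Jn IJ mult_1_left I_def[symmetric])
qed

text \<open>Modulo \<open>1 - W\<close> the cleared equation reads \<open>2 n P = 0\<close>, so a pole of too high order cancels.\<close>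

lemma pole_step:
  assumes P: "P \<in> mspan UNIV" and H: "H \<in> mspan UNIV" and "m \<le> n"
    and ode: "of_nat k * (J ^ Suc n * P) + Eul (J ^ Suc n * P) = J ^ Suc m * H"
  shows "J ^ Suc n * P \<in> rspan UNIV n"
proof -
  define P' where "P' = of_nat (2 * Suc n) * P + (1 - W) ^ (n - m) * H - (of_nat k * P + Eul P)"
  have P': "P' \<in> mspan UNIV"
    unfolding P'_def by (intro mspan_add mspan_diff mspan_of_nat mspan_one_minus_W_power mspan_Eul P H diag_closed_UNIV)
  have "(1 - W) * (of_nat k * P + Eul P) + of_nat (2 * Suc n) * (W * P) = (1 - W) * ((1 - W) ^ (n - m) * H)"
    using Eul_clear_denominators[OF ode] assms(3) by (simp add: Suc_diff_le mult.assoc)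
  then have "of_nat (Suc (Suc (2 * n))) * P = (1 - W) * P'"
    unfolding P'_def by (simp add: algebra_simps)
  then have "P = const2 (1 / of_nat (Suc (Suc (2 * n)))) * ((1 - W) * P')"
    by (metis of_nat_divide_fps2)
  then have "J ^ Suc n * P = J ^ n * (J * (1 - W)) * (const2 (1 / of_nat (Suc (Suc (2 * n)))) * P')"
    by (simp only: power_Suc mult_ac)
  then show ?thesis using rspanI[OF mspan_scale[OF P']] by (simp only: J_inverse mult_1_right)
qed

text \<open>Pole orders above \<open>m\<close> are removed one at a time by
  \<open>pole_step\<close>. Thus the solution has one order less than the right-hand side.\<close>

lemma pole_reduce:
  assumes "A \<in> rspan UNIV n" "H \<in> mspan UNIV" "of_nat k * A + Eul A = J ^ Suc m * H"
  shows "A \<in> rspan UNIV m"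
  using assms(1)
proof (induction n)
  case 0
  then show ?case by (rule rspan_mono[OF _ diag_closed_UNIV]) auto
next
  case (Suc n)
  show ?case
  proof (cases "m \<le> n")
    case True
    obtain P where "A = J ^ Suc n * P" "P \<in> mspan UNIV" using Suc.prems by (auto simp: rspan_def)
    then show ?thesis using Suc.IH pole_step[OF _ assms(2) True, of P k] assms(3) by simp
  next
    case False
    show ?thesis by (rule rspan_mono[OF Suc.prems diag_closed_UNIV]) (use False in auto)
  qed
qed

section \<open>Leading monomials and algebraic independence of \<open>T_x\<close> and
  \<open>T_y\<close>\<close>

definition leads :: "nat \<Rightarrow> nat \<Rightarrow> fps2 \<Rightarrow> bool" where
  "leads a b A \<longleftrightarrow> (\<forall>i j. i < a \<or> j < b \<longrightarrow> A $ i $ j = 0) \<and> A $ a $ b = 1"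

lemma leads_mult:
  assumes "leads a b A" "leads c d B"
  shows "leads (a + c) (b + d) (A * B)"
proof -
  have A: "A $ i $ j = 0" if "i < a \<or> j < b" for i j using assms(1) that by (auto simp: leads_def)
  have B: "B $ i $ j = 0" if "i < c \<or> j < d" for i j using assms(2) that by (auto simp: leads_def)
  have "(A * B) $ i $ j = 0" if "i < a + c \<or> j < b + d" for i j
    unfolding fps2_mult_nth
  proof (intro sum.neutral ballI)
    fix p q assume "p \<in> {0..i}" "q \<in> {0..j}"
    then have "(p < a \<or> q < b) \<or> (i - p < c \<or> j - q < d)" using that by auto
    then show "A $ p $ q * B $ (i - p) $ (j - q) = 0" using A B by auto
  qed
  moreover have "(A * B) $ (a + c) $ (b + d) = 1"
  proof -
    have "(A * B) $ (a + c) $ (b + d) = (\<Sum>p=0..a + c. \<Sum>q=0..b + d. if p = a \<and> q = b then 1 else 0)"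
      unfolding fps2_mult_nth
    proof (intro sum.cong refl)
      fix p q assume "p \<in> {0..a + c}" "q \<in> {0..b + d}"
      moreover from this have "p = a \<and> q = b \<or> (p < a \<or> q < b) \<or> (a + c - p < c \<or> b + d - q < d)" by auto
      ultimately show "A $ p $ q * B $ (a + c - p) $ (b + d - q) = (if p = a \<and> q = b then 1 else 0)"
        using A B assms by (auto simp: leads_def)
    qed
    also have "\<dots> = (\<Sum>p=0..a + c. if p = a then 1 else 0)"
      by (intro sum.cong refl) (auto simp: sum.delta)
    finally show ?thesis by simp
  qed
  ultimately show ?thesis by (simp add: leads_def)
qed

lemma leads_one: "leads 0 0 1"
  by (simp add: leads_def)

lemma leads_T_x: "leads 1 0 T_x"
  by (simp add: leads_def T_x_eq F_def N_bi_def)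

lemma leads_T_y: "leads 0 1 T_y"
  by (simp add: leads_def T_y_eq F_def N_bi_def)

lemma leads_monomial: "leads a b (T_x ^ a * T_y ^ b)"
proof -
  have "leads a 0 (T_x ^ a)"
    by (induction a) (use leads_mult[OF leads_T_x] leads_one in auto)
  moreover have "leads 0 b (T_y ^ b)"
    by (induction b) (use leads_mult[OF leads_T_y] leads_one in auto)
  ultimately show ?thesis using leads_mult by fastforce
qed

text \<open>\<open>polyrel C A\<close>: the polynomial \<open>C\<close> in \<open>x, y\<close> becomes \<open>A\<close> under \<open>x \<mapsto> T_x\<close>, \<open>y \<mapsto> T_y\<close>.\<close>

inductive polyrel :: "fps2 \<Rightarrow> fps2 \<Rightarrow> bool" where
  zero: "polyrel 0 0"
| step: "polyrel C A \<Longrightarrow> polyrel (C + const2 c * (fps_X ^ a * fps_const fps_X ^ b)) (A + const2 c * (T_x ^ a * T_y ^ b))"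

lemma monomial_nth:
  "(const2 c * (fps_X ^ a * fps_const fps_X ^ b)) $ i $ j = (if i = a \<and> j = b then c else 0)"
  by (auto simp: fps_const_power fps_X_power_mult_nth)

lemma polyrel_add:
  assumes "polyrel C A" "polyrel D B"
  shows "polyrel (C + D) (A + B)"
  using assms(2) by induction (simp_all only: assms(1) add.assoc[symmetric] add_0_right polyrel.step)

lemma polyrel_monomial: "polyrel (const2 c * (fps_X ^ a * fps_const fps_X ^ b)) (const2 c * (T_x ^ a * T_y ^ b))"
  using polyrel.step[OF polyrel.zero] by simp

lemma polyrel_scale: "polyrel C A \<Longrightarrow> polyrel (const2 e * C) (const2 e * A)"
proof (induction rule: polyrel.induct)
  case zero
  then show ?case by (simp add: polyrel.zero)
next
  case (step C A c a b)
  have "polyrel (const2 (e * c) * (fps_X ^ a * fps_const fps_X ^ b)) (const2 (e * c) * (T_x ^ a * T_y ^ b))"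
    by (rule polyrel_monomial)
  then have "polyrel (const2 e * (const2 c * (fps_X ^ a * fps_const fps_X ^ b))) (const2 e * (const2 c * (T_x ^ a * T_y ^ b)))"
    by (simp only: fps_const_mult[symmetric] mult.assoc)
  with step.IH show ?case by (simp only: distrib_left polyrel_add)
qed

lemma polyrel_of_nat: "polyrel C A \<Longrightarrow> polyrel (of_nat n * C) (of_nat n * A)"
  using polyrel_scale[of C A "of_nat n"] by (simp only: const2_of_nat)

lemma polyrel_diff: "polyrel C A \<Longrightarrow> polyrel D B \<Longrightarrow> polyrel (C - D) (A - B)"
  using polyrel_add[OF _ polyrel_scale[of D B "-1"]] by (fastforce simp flip: fps_const_neg)

lemma polyrel_W: "polyrel C A \<Longrightarrow> polyrel (fps_X * fps_const fps_X * C) (W * A)"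
proof (induction rule: polyrel.induct)
  case zero
  then show ?case by (simp add: polyrel.zero)
next
  case (step C A c a b)
  have "polyrel (const2 c * (fps_X ^ Suc a * fps_const fps_X ^ Suc b)) (const2 c * (T_x ^ Suc a * T_y ^ Suc b))"
    by (rule polyrel_monomial)
  then have "polyrel (fps_X * fps_const fps_X * (const2 c * (fps_X ^ a * fps_const fps_X ^ b))) (W * (const2 c * (T_x ^ a * T_y ^ b)))"
    by (simp only: W_def power_Suc mult_ac)
  with step.IH show ?case by (simp only: distrib_left polyrel_add)
qed

lemma polyrel_Eul: "polyrel C A \<Longrightarrow> polyrel (Dx C + Dy C) (Eul A)"
proof (induction rule: polyrel.induct)
  case zero
  have "Dx 0 + Dy 0 = (0 :: fps2)" by (rule fps2_eqI) simp
  then show ?case using Eul_const2[of 0] by (simp add: polyrel.zero)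
next
  case (step C A c a b)
  have "Eul (const2 c * (T_x ^ a * T_y ^ b)) = of_nat (a + b) * (const2 c * (T_x ^ a * T_y ^ b))"
    using Eul_power_log[of T_x 1 a] Eul_power_log[of T_y 1 b]
    by (simp add: Eul_mult Eul_const2 Eul_T_x Eul_T_y algebra_simps)
  moreover have "Dx (const2 c * (fps_X ^ a * fps_const fps_X ^ b)) + Dy (const2 c * (fps_X ^ a * fps_const fps_X ^ b))
      = of_nat (a + b) * (const2 c * (fps_X ^ a * fps_const fps_X ^ b))"
    by (rule fps2_eqI) (simp only: fps_add_nth Dx_nth Dy_nth of_nat_fps2_mult_nth monomial_nth, simp add: distrib_right)
  ultimately have "polyrel (Dx (const2 c * (fps_X ^ a * fps_const fps_X ^ b)) + Dy (const2 c * (fps_X ^ a * fps_const fps_X ^ b)))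
      (Eul (const2 c * (T_x ^ a * T_y ^ b)))"
    by (simp only: polyrel_of_nat polyrel_monomial)
  from polyrel_add[OF step.IH this] show ?case by (simp only: Eul_add Dx_add Dy_add add_ac)
qed

lemma mspan_polyrel:
  "A \<in> mspan M \<Longrightarrow> \<exists>C. polyrel C A \<and> (\<forall>a b. (a, b) \<notin> M \<longrightarrow> C $ a $ b = 0)"
proof (induction rule: mspan.induct)
  case zero
  show ?case by (rule exI[of _ 0]) (simp add: polyrel.zero)
next
  case (step A a b c)
  then obtain C where "polyrel C A" "\<forall>a b. (a, b) \<notin> M \<longrightarrow> C $ a $ b = 0" by blast
  with step(2) show ?case
    by (intro exI[of _ "C + const2 c * (fps_X ^ a * fps_const fps_X ^ b)"] conjI polyrel.step)
      (simp_all only: fps_add_nth monomial_nth, auto)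
qed

text \<open>Holding for all large \<open>M\<close> rather than one, so that the range can grow when
  the induction adds a monomial.\<close>

lemma polyrel_sum:
  "polyrel C A \<Longrightarrow> \<exists>N. \<forall>M\<ge>N. A = (\<Sum>a<M. \<Sum>b<M. const2 (C $ a $ b) * (T_x ^ a * T_y ^ b)) \<and>
    (\<forall>a b. a \<ge> M \<or> b \<ge> M \<longrightarrow> C $ a $ b = 0)"
proof (induction rule: polyrel.induct)
  case zero
  then show ?case by auto
next
  case (step C A c a b)
  then obtain N where N: "\<And>M. M \<ge> N \<Longrightarrow> A = (\<Sum>a<M. \<Sum>b<M. const2 (C $ a $ b) * (T_x ^ a * T_y ^ b)) \<and>
    (\<forall>a b. a \<ge> M \<or> b \<ge> M \<longrightarrow> C $ a $ b = 0)" by blast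
  define C' where "C' = C + const2 c * (fps_X ^ a * fps_const fps_X ^ b)"
  have C': "C' $ i $ j = C $ i $ j + (if i = a \<and> j = b then c else 0)" for i j
    unfolding C'_def by (simp only: fps_add_nth monomial_nth)
  have "A + const2 c * (T_x ^ a * T_y ^ b) = (\<Sum>i<M. \<Sum>j<M. const2 (C' $ i $ j) * (T_x ^ i * T_y ^ j)) \<and>
    (\<forall>i j. i \<ge> M \<or> j \<ge> M \<longrightarrow> C' $ i $ j = 0)" if M: "M \<ge> max N (max (Suc a) (Suc b))" for M
  proof
    have "(\<Sum>i<M. \<Sum>j<M. const2 (C' $ i $ j) * (T_x ^ i * T_y ^ j))
      = (\<Sum>i<M. \<Sum>j<M. const2 (C $ i $ j) * (T_x ^ i * T_y ^ j))
        + (\<Sum>i<M. \<Sum>j<M. const2 (if i = a \<and> j = b then c else 0) * (T_x ^ i * T_y ^ j))"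
      by (simp only: C' fps_const_add[symmetric] distrib_right sum.distrib)
    also have "(\<Sum>i<M. \<Sum>j<M. const2 (if i = a \<and> j = b then c else 0) * (T_x ^ i * T_y ^ j))
      = (\<Sum>i<M. if i = a then const2 c * (T_x ^ a * T_y ^ b) else 0)"
    proof (intro sum.cong refl)
      fix i
      have "(\<Sum>j<M. const2 (if i = a \<and> j = b then c else 0) * (T_x ^ i * T_y ^ j))
        = (\<Sum>j<M. if j = b then (if i = a then const2 c * (T_x ^ a * T_y ^ b) else 0) else 0)"
        by (intro sum.cong refl) auto
      also have "\<dots> = (if i = a then const2 c * (T_x ^ a * T_y ^ b) else 0)"
      proof -
        have "b < M" using M by linarith
        then show ?thesis by simp
      qed
      finally show "(\<Sum>j<M. const2 (if i = a \<and> j = b then c else 0) * (T_x ^ i * T_y ^ j))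
        = (if i = a then const2 c * (T_x ^ a * T_y ^ b) else 0)" .
    qed
    also have "\<dots> = const2 c * (T_x ^ a * T_y ^ b)"
    proof -
      have "a < M" using M by linarith
      then show ?thesis by simp
    qed
    finally show "A + const2 c * (T_x ^ a * T_y ^ b) = (\<Sum>i<M. \<Sum>j<M. const2 (C' $ i $ j) * (T_x ^ i * T_y ^ j))"
      using N[of M] M by simp
    show "\<forall>i j. i \<ge> M \<or> j \<ge> M \<longrightarrow> C' $ i $ j = 0" using N[of M] M by (auto simp: C')
  qed
  then show ?case unfolding C'_def by blast
qed

lemma polyrel_mspan:
  assumes "polyrel C A" "\<And>a b. (a, b) \<notin> M \<Longrightarrow> C $ a $ b = 0"
  shows "A \<in> mspan M"
proof -
  obtain N where A: "A = (\<Sum>a<N. \<Sum>b<N. const2 (C $ a $ b) * (T_x ^ a * T_y ^ b))"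
    using polyrel_sum[OF assms(1)] by blast
  have "const2 (C $ a $ b) * (T_x ^ a * T_y ^ b) \<in> mspan M" for a b
    using assms(2)[of a b] mspan_monomial[of a b M] mspan.zero by (cases "(a, b) \<in> M") auto
  then show ?thesis unfolding A by (intro mspan_sum)
qed

text \<open>\<open>T_x\<close> and \<open>T_y\<close> are algebraically independent.\<close>

lemma polyrel_zero:
  assumes "polyrel C 0"
  shows "C = 0"
proof -
  obtain N where N: "0 = (\<Sum>a<N. \<Sum>b<N. const2 (C $ a $ b) * (T_x ^ a * T_y ^ b))"
    "\<And>a b. a \<ge> N \<or> b \<ge> N \<Longrightarrow> C $ a $ b = 0"
    using polyrel_sum[OF assms] by blast
  have "\<forall>a b. a + b = n \<longrightarrow> C $ a $ b = 0" for n
  proof (induction n rule: less_induct)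
    case (less n)
    show ?case
    proof (intro allI impI)
      fix a b assume n: "a + b = n"
      show "C $ a $ b = 0"
      proof (cases "a < N \<and> b < N")
        case True
        \<comment> \<open>Terms with i > a or j > b start beyond the position (a, b); those below it
          have smaller total degree and vanish by induction.\<close>
        have term_nth: "C $ i $ j * (T_x ^ i * T_y ^ j) $ a $ b = (if j = b then if i = a then C $ a $ b else 0 else 0)" for i j
        proof (cases "a < i \<or> b < j")
          case True
          then have "(T_x ^ i * T_y ^ j) $ a $ b = 0" using leads_monomial[of i j] by (auto simp: leads_def)
          then show ?thesis using True by auto
        next
          case False
          show ?thesis
          proof (cases "i = a \<and> j = b")
            case True
            then show ?thesis using leads_monomial[of i j] by (auto simp: leads_def)
          next
            case neq: False
            then have "i + j < n" using False n by auto
            then have "C $ i $ j = 0" using less by blast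
            then show ?thesis using neq by auto
          qed
        qed
        have "0 = (\<Sum>i<N. \<Sum>j<N. C $ i $ j * (T_x ^ i * T_y ^ j) $ a $ b)"
          using arg_cong[OF N(1), of "\<lambda>A. A $ a $ b"]
          by (simp only: fps_sum_nth fps_mult_left_const_nth fps_zero_nth)
        also have "\<dots> = C $ a $ b" unfolding term_nth using True by simp
        finally show ?thesis by simp
      qed (use N(2)[of a b] in auto)
    qed
  qed
  then show ?thesis by (intro fps2_eqI) auto
qed

text \<open>After clearing denominators, algebraic independence allows comparing coefficients. That
  of (a, b) is multiplied by k + a + b, which is nonzero, and otherwise only (a - 1, b - 1) enters,
  so support outside the band cannot arise.\<close>

lemma Eul_band:
  assumes A: "A \<in> ratl" and H: "H \<in> rspan (band d) (Suc m)" and k: "k \<ge> 1"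
    and ode: "of_nat k * A + Eul A = H"
  shows "A \<in> rspan (band d) m"
proof -
  obtain H' where H': "H = J ^ Suc m * H'" "H' \<in> mspan (band d)" using H by (auto simp: rspan_def)
  obtain n where "A \<in> rspan UNIV n" using A by (auto simp: ratl_def)
  then have "A \<in> rspan UNIV m"
    using pole_reduce[of A n H' k m] mspan_mono[OF H'(2)] ode H'(1) by simp
  then obtain P where P: "A = J ^ m * P" "P \<in> mspan UNIV" by (auto simp: rspan_def)
  have eq: "(1 - W) * (of_nat k * P + Eul P) + of_nat (2 * m) * (W * P) = H'"
    using Eul_clear_denominators[of k m P m H'] ode P H' by simp
  obtain C where C: "polyrel C P" using mspan_polyrel[OF P(2)] by blast
  obtain D where D: "polyrel D H'" "\<And>a b. (a, b) \<notin> band d \<Longrightarrow> D $ a $ b = 0"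
    using mspan_polyrel[OF H'(2)] by blast
  define w where "w = (fps_X * fps_const fps_X :: fps2)"
  define C' where "C' = of_nat k * C + (Dx C + Dy C)"
  have "polyrel (C' - w * C' + of_nat (2 * m) * (w * C) - D) (0)"
  proof -
    have C': "polyrel C' (of_nat k * P + Eul P)"
      unfolding C'_def by (intro polyrel_add polyrel_of_nat polyrel_Eul C)
    have "polyrel (C' - w * C' + of_nat (2 * m) * (w * C) - D)
      ((of_nat k * P + Eul P) - W * (of_nat k * P + Eul P) + of_nat (2 * m) * (W * P) - H')"
      unfolding w_def by (intro polyrel_add polyrel_diff polyrel_of_nat polyrel_W C C' D)
    then show ?thesis by (simp add: eq[symmetric] algebra_simps)
  qed
  then have D_eq: "D = C' - w * C' + of_nat (2 * m) * (w * C)"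
    using polyrel_zero by (metis eq_iff_diff_eq_0)
  have w_nth: "(w * E) $ a $ b = (if a = 0 \<or> b = 0 then 0 else E $ (a - 1) $ (b - 1))" for E a b
    by (cases a) (simp_all add: w_def mult.assoc)
  have "\<forall>b. (a, b) \<notin> band d \<longrightarrow> C $ a $ b = 0" for a
  proof (induction a)
    case 0
    show ?case
    proof (intro allI impI)
      fix b assume "(0, b) \<notin> band d"
      then have "0 = of_nat (k + b) * C $ 0 $ b"
        using arg_cong[OF D_eq, of "\<lambda>A. A $ 0 $ b"] D(2)[of 0 b]
        by (simp only: fps_add_nth fps_sub_nth of_nat_fps2_mult_nth w_nth) (simp add: C'_def of_nat_fps2_mult_nth algebra_simps)
      then show "C $ 0 $ b = 0" using k by simp
    qed
  next
    case (Suc a)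
    show ?case
    proof (intro allI impI)
      fix b assume b: "(Suc a, b) \<notin> band d"
      have prev: "C $ a $ (b - 1) = 0" if "b \<noteq> 0"
      proof -
        \<comment> \<open>Contrapositive of closure of the band under the diagonal step.\<close>
        have "(a, b - 1) \<notin> band d" using b that by (auto simp: band_def)
        then show ?thesis using Suc by blast
      qed
      have prev': "C' $ a $ (b - 1) = 0" if "b \<noteq> 0"
        using prev[OF that] by (simp add: C'_def of_nat_fps2_mult_nth)
      have "0 = of_nat (k + Suc a + b) * C $ Suc a $ b"
        using arg_cong[OF D_eq, of "\<lambda>A. A $ Suc a $ b"] D(2)[OF b] prev prev'
        by (simp only: fps_add_nth fps_sub_nth of_nat_fps2_mult_nth w_nth)
          (simp add: C'_def of_nat_fps2_mult_nth algebra_simps split: if_splits)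
      then show "C $ Suc a $ b = 0" using k by simp
    qed
  qed
  then have "P \<in> mspan (band d)" using polyrel_mspan[OF C] by blast
  then show ?thesis unfolding P(1) by (rule rspanI)
qed

text \<open>The derivative is a separate conjunct because at k = 1 it is the only part available.
  Its bound 3 k - 1 is 3 (k - 1) + 2.\<close>

lemma F_band: "k \<ge> 1 \<Longrightarrow> Dx (F k) \<in> xband (k - 1) (3 * k - 1) \<and> (k \<ge> 2 \<longrightarrow> F k \<in> rspan (band (k - 1)) (3 * (k - 1)))"
proof (induction k rule: less_induct)
  case (less k)
  show ?case
  proof (cases "k = 1")
    case True
    then show ?thesis using Dx_F_1 by simp
  next
    case False
    with less.prems obtain l where k: "k = Suc (Suc l)"
      by (metis One_nat_def Suc_le_D not_one_le_zero old.nat.exhaust)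
    define n where "n = Suc l"
    have IH: "Dx (F i) \<in> xband (i - 1) (3 * i - 1)" if "1 \<le> i" "i \<le> n" for i
      using less.IH[of i] that k n_def by auto
    have xn: "Dx (F n) \<in> xband l (3 * l + 2)" using IH[of n] by (simp add: n_def numeral_eq_Suc)
    have x1: "Dx (F n) \<in> rspan (band n) (3 * n + 1)"
      using xband_rspan[OF xn] by (rule rspan_band_mono) (auto simp: n_def)
    have x2: "Dy (F n) \<in> rspan (band n) (3 * n + 1)"
      using rspan_swap[OF x1 diag_closed_band] by (simp add: swap_Dx_F)
    \<comment> \<open>With n = l + 1 the order is (3 l + 2) + 2 = 3 n + 1, the same as for the
      products in \<open>x5\<close>.\<close>
    have x3: "Dx (Dy (F n)) \<in> rspan (band n) (3 * n + 1)"
      unfolding Dx_Dy_commute using Dy_xband[OF xn] by (rule rspan_band_mono) (auto simp: n_def)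
    have x4: "of_nat (n - 1) * F n \<in> rspan (band n) (3 * n + 1)"
    proof (cases "n = 1")
      case False
      then have "F n \<in> rspan (band (n - 1)) (3 * (n - 1))" using less.IH[of n] k n_def by auto
      then have "F n \<in> rspan (band n) (3 * n + 1)" by (rule rspan_band_mono) auto
      then show ?thesis by (rule rspan_of_nat)
    qed (simp add: rspan_zero)
    have x5: "Dx (F i) * Dy (F (Suc n - i)) \<in> rspan (band n) (3 * n + 1)" if "i \<in> {1..n}" for i
    proof -
      have "Dx (F (Suc n - i)) \<in> xband (Suc n - i - 1) (3 * (Suc n - i) - 1)" using that by (intro IH) auto
      then have "fps2_swap (Dy (F (Suc n - i))) \<in> xband (n - i) (3 * (Suc n - i) - 1)" by (simp add: swap_Dy_F)
      moreover have "Dx (F i) \<in> xband (i - 1) (3 * i - 1)" using that by (intro IH) auto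
      ultimately have "Dx (F i) * Dy (F (Suc n - i)) \<in> rspan (band (Suc (i - 1 + (n - i)))) (3 * i - 1 + (3 * (Suc n - i) - 1))"
        by (intro xband_swap_mult)
      moreover have "Suc (i - 1 + (n - i)) = n" "3 * i - 1 + (3 * (Suc n - i) - 1) = 3 * n + 1" using that by auto
      ultimately show ?thesis by (simp only:)
    qed
    have "edge_rhs n \<in> rspan (band n) (Suc (3 * n))"
      unfolding edge_rhs_def using x1 x2 x3 x4 x5 by (intro rspan_add rspan_diff rspan_sum) auto
    then have "F (Suc n) \<in> rspan (band n) (3 * n)"
      using Eul_band[OF F_ratl _ _ Eul_F] by (simp add: n_def)
    then show ?thesis
      using Dx_xband[of "F (Suc n)" n "3 * n"] by (simp add: k n_def)
  qed
qed

section \<open>Symmetric polynomials in \<open>T_x\<close>, \<open>T_y\<close> as polynomials in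
  \<open>Z\<close> and \<open>W\<close>\<close>

lemma eval_poly_monom: "eval_poly (monom c n) A = const2 c * A ^ n"
  by (simp add: eval_poly_def map_poly_monom poly_monom)

lemma eval_poly_add: "eval_poly (p + q) A = eval_poly p A + eval_poly q A"
proof -
  have "map_poly const2 (p + q) = map_poly const2 p + map_poly const2 q"
    by (rule poly_eqI) (simp add: coeff_map_poly fps_const_add)
  then show ?thesis by (simp add: eval_poly_def)
qed

lemma eval_poly_zero: "eval_poly 0 A = 0"
  by (simp add: eval_poly_def)

definition ZW_poly :: "nat \<Rightarrow> fps2 set" where
  "ZW_poly d = {A. \<exists>q. A = (\<Sum>j=0..d. eval_poly (q j) W * Z ^ j)}"

lemma ZW_poly_monomial: "j \<le> d \<Longrightarrow> const2 c * (W ^ i * Z ^ j) \<in> ZW_poly d"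
proof -
  assume "j \<le> d"
  have "(\<Sum>l=0..d. eval_poly (if l = j then monom c i else 0) W * Z ^ l)
      = (\<Sum>l=0..d. if l = j then const2 c * (W ^ i * Z ^ j) else 0)"
    by (intro sum.cong) (auto simp: eval_poly_monom eval_poly_zero mult.assoc)
  then have "const2 c * (W ^ i * Z ^ j) = (\<Sum>l=0..d. eval_poly (if l = j then monom c i else 0) W * Z ^ l)"
    using \<open>j \<le> d\<close> by simp
  then show ?thesis unfolding ZW_poly_def mem_Collect_eq by (intro exI)
qed

lemma ZW_poly_add: "A \<in> ZW_poly d \<Longrightarrow> B \<in> ZW_poly d \<Longrightarrow> A + B \<in> ZW_poly d"
proof -
  assume "A \<in> ZW_poly d" "B \<in> ZW_poly d"
  then obtain p q where "A = (\<Sum>j=0..d. eval_poly (p j) W * Z ^ j)" "B = (\<Sum>j=0..d. eval_poly (q j) W * Z ^ j)"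
    by (auto simp: ZW_poly_def)
  then have "A + B = (\<Sum>j=0..d. eval_poly (p j + q j) W * Z ^ j)"
    by (simp add: eval_poly_add distrib_right sum.distrib)
  then show ?thesis unfolding ZW_poly_def mem_Collect_eq by (rule exI[of _ "\<lambda>j. p j + q j"])
qed

lemma ZW_poly_mult_monomial:
  assumes "A \<in> ZW_poly d" "d + j \<le> e"
  shows "const2 c * (W ^ i * Z ^ j) * A \<in> ZW_poly e"
proof -
  obtain q where A: "A = (\<Sum>l=0..d. eval_poly (q l) W * Z ^ l)" using assms by (auto simp: ZW_poly_def)
  have ZW_sum: "sum f I \<in> ZW_poly e" if "\<And>x. x \<in> I \<Longrightarrow> f x \<in> ZW_poly e" for f :: "nat \<Rightarrow> fps2" and I
    using that ZW_poly_monomial[of 0 e 0 0] by (induction I rule: infinite_finite_induct) (auto intro: ZW_poly_add)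
  have term_mem: "const2 c * (W ^ i * Z ^ j) * (eval_poly p W * Z ^ l) \<in> ZW_poly e" if "l \<le> d" for l p
  proof -
    have "eval_poly p W = (\<Sum>n\<le>degree p. const2 (coeff p n) * W ^ n)"
      by (simp add: eval_poly_def poly_altdef coeff_map_poly degree_map_poly)
    then have "const2 c * (W ^ i * Z ^ j) * (eval_poly p W * Z ^ l)
        = (\<Sum>n\<le>degree p. const2 c * (W ^ i * Z ^ j) * (const2 (coeff p n) * W ^ n * Z ^ l))"
      by (simp only: sum_distrib_left sum_distrib_right)
    also have "\<dots> = (\<Sum>n\<le>degree p. const2 (c * coeff p n) * (W ^ (i + n) * Z ^ (j + l)))"
      by (simp only: fps_const_mult[symmetric] power_add mult_ac)
    finally show ?thesis using that assms(2) by (simp only:) (intro ZW_sum ZW_poly_monomial, simp)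
  qed
  show ?thesis unfolding A sum_distrib_left using term_mem by (intro ZW_sum) auto
qed

lemma power_sum_ZW: "T_x ^ n + T_y ^ n \<in> ZW_poly n"
proof (induction n rule: less_induct)
  case (less n)
  consider "n = 0" | "n = 1" | m where "n = Suc (Suc m)" by (metis One_nat_def old.nat.exhaust)
  then show ?case
  proof cases
    case 1
    then show ?thesis using ZW_poly_monomial[of 0 0 2 0] by (simp add: numeral_fps_const)
  next
    case 2
    then show ?thesis using ZW_poly_monomial[of 1 1 1 0] by (simp add: Z_def)
  next
    case 3
    \<comment> \<open>Newton's recurrence \<open>p_n = Z p_(n-1) - W p_(n-2)\<close> for power sums
      in two variables.\<close>
    have "T_x ^ n + T_y ^ n = const2 1 * (W ^ 0 * Z ^ 1) * (T_x ^ Suc m + T_y ^ Suc m)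
        + const2 (-1) * (W ^ 1 * Z ^ 0) * (T_x ^ m + T_y ^ m)"
      by (simp add: 3 Z_def W_def algebra_simps flip: fps_const_neg)
    also have "\<dots> \<in> ZW_poly n"
      by (rule ZW_poly_add; rule ZW_poly_mult_monomial[OF less]) (simp_all add: 3)
    finally show ?thesis .
  qed
qed

text \<open>A monomial plus its mirror image is \<open>W ^ p\<close> times a power sum of degree |a
  - b|, where p is the smaller exponent. Here p \<ge> 2 gives \<open>W ^ 2\<close>, and |a - b|
  \<le> d bounds the degree in \<open>Z\<close>.\<close>

lemma symmetrize_band:
  assumes "A \<in> mspan (band d)"
  shows "\<exists>B\<in>ZW_poly d. A + fps2_swap A = W ^ 2 * B"
  using assms
proof induction
  case zero
  then show ?case using ZW_poly_monomial[of 0 d 0 0] by (intro bexI[of _ 0]) auto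
next
  case (step A a b c)
  have sym: "\<exists>B\<in>ZW_poly d. const2 c * (T_x ^ p * T_y ^ q) + const2 c * (T_x ^ q * T_y ^ p) = W ^ 2 * B"
    if "p \<ge> 2" "q \<ge> p" "q \<le> p + d" for p q
  proof
    have "T_x ^ p * T_y ^ q + T_x ^ q * T_y ^ p = W ^ p * (T_x ^ (q - p) + T_y ^ (q - p))"
      using that by (simp add: W_def power_mult_distrib algebra_simps flip: power_add)
    also have "W ^ p = W ^ 2 * W ^ (p - 2)" using that by (metis le_add_diff_inverse power_add)
    finally show "const2 c * (T_x ^ p * T_y ^ q) + const2 c * (T_x ^ q * T_y ^ p)
        = W ^ 2 * (const2 c * (W ^ (p - 2) * Z ^ 0) * (T_x ^ (q - p) + T_y ^ (q - p)))"
      by (simp only: distrib_left[symmetric] power_0 mult_1_left mult_1_right mult_ac)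
    show "const2 c * (W ^ (p - 2) * Z ^ 0) * (T_x ^ (q - p) + T_y ^ (q - p)) \<in> ZW_poly d"
      by (rule ZW_poly_mult_monomial[OF power_sum_ZW]) (use that in simp)
  qed
  have "\<exists>B\<in>ZW_poly d. const2 c * (T_x ^ a * T_y ^ b) + const2 c * (T_x ^ b * T_y ^ a) = W ^ 2 * B"
    using sym[of a b] sym[of b a] step(2) by (cases "a \<le> b") (auto simp: band_def add.commute)
  then obtain B where B: "B \<in> ZW_poly d"
    "const2 c * (T_x ^ a * T_y ^ b) + const2 c * (T_x ^ b * T_y ^ a) = W ^ 2 * B" by blast
  obtain B' where B': "B' \<in> ZW_poly d" "A + fps2_swap A = W ^ 2 * B'" using step.IH by blast
  have "fps2_swap (const2 c * (T_x ^ a * T_y ^ b)) = const2 c * (T_x ^ b * T_y ^ a)"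
    by (simp add: fps2_swap_mult fps2_swap_power swap_T_x swap_T_y swap_const2 mult.commute)
  then have "A + const2 c * (T_x ^ a * T_y ^ b) + fps2_swap (A + const2 c * (T_x ^ a * T_y ^ b))
      = (A + fps2_swap A) + (const2 c * (T_x ^ a * T_y ^ b) + const2 c * (T_x ^ b * T_y ^ a))"
    by (simp only: fps2_swap_add add_ac)
  also have "\<dots> = W ^ 2 * (B' + B)" by (simp only: B B' distrib_left)
  finally show ?case using ZW_poly_add[OF B'(1) B(1)] by blast
qed

theorem theorem1p7:
  fixes k :: nat
  assumes "k \<ge> 2"
  shows "\<exists>(q :: nat \<Rightarrow> rat poly) (f :: fps2 \<Rightarrow> fps2 \<Rightarrow> fps2).
    (\<forall>z w. f z w = w ^ 2 / (1 - w) ^ (3 * (k - 1)) * (\<Sum>j = 0..k - 1. eval_poly (q j) w * z ^ j)) \<and>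
    F k = f Z W"
proof -
  define n where "n = 3 * (k - 1)"
  have "F k \<in> rspan (band (k - 1)) n" using F_band[of k] assms by (simp add: n_def)
  then obtain A where A: "F k = J ^ n * A" "A \<in> mspan (band (k - 1))" by (auto simp: rspan_def)
  \<comment> \<open>Averaging this with the original expression replaces \<open>A\<close> by a
    symmetric numerator, without having to show that \<open>A\<close> itself is symmetric.\<close>
  have swap: "F k = J ^ n * fps2_swap A"
    using arg_cong[OF A(1), of fps2_swap] by (simp add: swap_F fps2_swap_mult fps2_swap_power swap_J)
  obtain B where B: "B \<in> ZW_poly (k - 1)" "A + fps2_swap A = W ^ 2 * B"
    using symmetrize_band[OF A(2)] by blast
  define B' where "B' = const2 (1 / 2) * (W ^ 0 * Z ^ 0) * B"
  have "B' \<in> ZW_poly (k - 1)" unfolding B'_def using B(1) by (rule ZW_poly_mult_monomial) simp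
  then obtain q where q: "B' = (\<Sum>j=0..k - 1. eval_poly (q j) W * Z ^ j)" by (auto simp: ZW_poly_def)
  have "of_nat (Suc 1) * F k = F k + F k" by simp
  also have "\<dots> = J ^ n * (A + fps2_swap A)" using A(1) swap by (simp only: distrib_left)
  finally have "const2 (1 / of_nat (Suc 1)) * (of_nat (Suc 1) * F k) = const2 (1 / 2) * (J ^ n * (W ^ 2 * B))"
    by (simp only: B(2)) simp
  then have "F k = J ^ n * W ^ 2 * B'"
    unfolding of_nat_divide_fps2 B'_def by (simp only: power_0 mult_1_left mult_1_right mult_ac)
  also have "J ^ n * W ^ 2 = W ^ 2 / (1 - W) ^ n"
  proof -
    have "W ^ 2 / (1 - W) ^ n * ((1 - W) ^ n * J ^ n) = W ^ 2 * J ^ n"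
      by (simp only: mult.assoc[symmetric] divide_one_minus_W_power)
    then show ?thesis using J_power_inverse[of n] by (simp add: mult.commute)
  qed
  finally have "F k = W ^ 2 / (1 - W) ^ (3 * (k - 1)) * (\<Sum>j = 0..k - 1. eval_poly (q j) W * Z ^ j)"
    by (simp only: q n_def)
  then show ?thesis
    by (intro exI[of _ q] exI[of _ "\<lambda>z w. w ^ 2 / (1 - w) ^ (3 * (k - 1)) * (\<Sum>j = 0..k - 1. eval_poly (q j) w * z ^ j)"]) simp
qed

end
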